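(* Let $\{\alpha_1,\dots,\alpha_n\}$ be an orthonormal set in $L_2[0,T]$, let $p_1,\dots,p_n$ be nonnegative integers, let $F(x)=\prod_{j=1}^n \langle \alpha_j,x\rangle^{2p_j}$ for $x\in C_0[0,T]$, and let $q$ be a nonzero real number. Then the $L_1$ analytic Fourier–Feynman transform $T_q^{(1)}(F)$ of $F$ exists and, for s-a.e. $y\in C_0[0,T]$, $$T_q^{(1)}(F)(y)=\prod_{j=1}^n \Bigl[ \sum_{s=0}^{p_j} {}_{2p_j} C_{2s}\, (2s-1)!!\,\Bigl(\frac{i}{q}\Bigr)^s \langle \alpha_j,y \rangle^{2p_j-2s} \Bigr].$$
   Context: $C_0[0,T]$ ($T>0$) is the space of real-valued continuous functions $x$ on $[0,T]$ with $x(0)=0$, with Wiener measure $m$ on the $\sigma$-algebra $\mathcal M$ of Wiener measurable sets. For $v\in L_2[0,T]$, $\langle v,x\rangle$ is the Paley–Wiener–Zygmund stochastic integral (Gaussian with mean $0$, variance $\|v\|_2^2$, linear in $x$). A set $B$ is scale-invariant measurable if $\rho B\in\mathcal M$ for all $\rho>0$, scale-invariant null if moreover $m(\rho B)=0$ for all $\rho>0$; "s-a.e." means outside a scale-invariant null set. $\mathbb C_+=\{\lambda\in\mathbb C:\mathrm{Re}\,\lambda>0\}$, and $\lambda^{1/2}$ is the principal square root. For a functional $G$ on $C_0[0,T]$ such that $J(\lambda)=\int_{C_0[0,T]}G(\lambda^{-1/2}x)\,m(dx)$ exists for all $\lambda>0$, if there is a function $J^*$ analytic on $\mathbb C_+$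 with $J^*=J$ on $(0,\infty)$, then $J^*(\lambda)$ is the analytic Wiener integral $\int^{\mathrm{anw}_\lambda}G(x)\,m(dx)$. For $\lambda\in\mathbb C_+$ and $y\in C_0[0,T]$, $T_\lambda(F)(y)=\int^{\mathrm{anw}_\lambda}_{C_0[0,T]}F(y+x)\,m(dx)$, and the $L_1$ analytic Fourier–Feynman transform is $T_q^{(1)}(F)(y)=\lim_{\lambda\to -iq,\ \lambda\in\mathbb C_+}T_\lambda(F)(y)$ for s-a.e. $y$. ${}_nC_k=\frac{n!}{k!(n-k)!}$; $(2s-1)!!=(2s-1)(2s-3)\cdots3\cdot1$ for $s\ge1$, $(-1)!!=1$. *)

theory Defs
  imports "HOL-Probability.Probability"
begin

text \<open>Elements of C_0[0,T] are represented as functions real => real that are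
continuous on [0,T], vanish at 0, and (canonically) vanish outside [0,T].
This set is closed under addition and real scaling.\<close>

definition C0 :: "real \<Rightarrow> (real \<Rightarrow> real) set" where
  "C0 T = {x. continuous_on {0..T} x \<and> x 0 = 0 \<and> (\<forall>t. t \<notin> {0..T} \<longrightarrow> x t = 0)}"

definition scale_path :: "real \<Rightarrow> (real \<Rightarrow> real) \<Rightarrow> (real \<Rightarrow> real)" where
  "scale_path \<rho> x = (\<lambda>t. \<rho> * x t)"

definition add_path :: "(real \<Rightarrow> real) \<Rightarrow> (real \<Rightarrow> real) \<Rightarrow> (real \<Rightarrow> real)" where
  "add_path y x = (\<lambda>t. y t + x t)"

text \<open>Borel sigma-algebra of C_0[0,T] (= sigma-algebra generated by the evaluations).\<close>

definition wiener_sets :: "real \<Rightarrow> (real \<Rightarrow> real) set set" where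
  "wiener_sets T = sigma_sets (C0 T)
     {{x \<in> C0 T. x t \<in> A} | t A. t \<in> {0..T} \<and> A \<in> sets borel}"

definition bm_property :: "real \<Rightarrow> (real \<Rightarrow> real) measure \<Rightarrow> bool" where
  "bm_property T M \<longleftrightarrow>
     (\<forall>(k::nat) (ts::nat \<Rightarrow> real).
        ts 0 = 0 \<and> (\<forall>i<k. ts i < ts (Suc i)) \<and> ts k \<le> T \<longrightarrow>
          prob_space.indep_vars M (\<lambda>_. borel) (\<lambda>i x. x (ts (Suc i)) - x (ts i)) {..<k} \<and>
          (\<forall>i<k. distributed M lborel (\<lambda>x. x (ts (Suc i)) - x (ts i))
                   (\<lambda>r. ennreal (normal_density 0 (sqrt (ts (Suc i) - ts i)) r))))"

text \<open>Wiener measure on the Borel sets of C_0[0,T] (uniquely determined by these properties).\<close>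

definition wiener :: "real \<Rightarrow> (real \<Rightarrow> real) measure" where
  "wiener T = (SOME M. prob_space M \<and> space M = C0 T \<and> sets M = wiener_sets T \<and> bm_property T M)"

definition wm :: "real \<Rightarrow> (real \<Rightarrow> real) measure" where
  "wm T = completion (wiener T)"

text \<open>Complete orthonormal system of real functions of bounded variation on [0,T]
(cosine basis) and its derivative.\<close>

definition cosb :: "real \<Rightarrow> nat \<Rightarrow> real \<Rightarrow> real" where
  "cosb T j t = (if j = 0 then 1 / sqrt T else sqrt (2 / T) * cos (real j * pi * t / T))"

definition cosb' :: "real \<Rightarrow> nat \<Rightarrow> real \<Rightarrow> real" where
  "cosb' T j t = (if j = 0 then 0 else - sqrt (2 / T) * (real j * pi / T) * sin (real j * pi * t / T))"

text \<open>Riemann--Stieltjes integral of the smooth basis function against a continuous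
path x with x 0 = 0, written via integration by parts.\<close>

definition rs_int :: "real \<Rightarrow> nat \<Rightarrow> (real \<Rightarrow> real) \<Rightarrow> real" where
  "rs_int T j x = cosb T j T * x T - (LINT t:{0..T}|lborel. x t * cosb' T j t)"

definition l2_coeff :: "real \<Rightarrow> (real \<Rightarrow> real) \<Rightarrow> nat \<Rightarrow> real" where
  "l2_coeff T v j = (LINT t:{0..T}|lebesgue. v t * cosb T j t)"

text \<open>PWZ integral: limit of the Riemann--Stieltjes integrals of the partial sums of the
expansion of v; 0 where the limit does not exist.\<close>

definition pwz :: "real \<Rightarrow> (real \<Rightarrow> real) \<Rightarrow> (real \<Rightarrow> real) \<Rightarrow> real" where
  "pwz T v x = (let S = (\<lambda>n. \<Sum>j<n. l2_coeff T v j * rs_int T j x) in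
                 if convergent S then lim S else 0)"

definition in_L2 :: "real \<Rightarrow> (real \<Rightarrow> real) \<Rightarrow> bool" where
  "in_L2 T v \<longleftrightarrow> set_borel_measurable lebesgue {0..T} v \<and>
                  set_integrable lebesgue {0..T} (\<lambda>t. (v t)\<^sup>2)"

definition orthonormal_L2 :: "real \<Rightarrow> nat \<Rightarrow> (nat \<Rightarrow> real \<Rightarrow> real) \<Rightarrow> bool" where
  "orthonormal_L2 T n \<alpha> \<longleftrightarrow> (\<forall>j<n. in_L2 T (\<alpha> j)) \<and>
     (\<forall>i<n. \<forall>j<n. (LINT t:{0..T}|lebesgue. \<alpha> i t * \<alpha> j t) = (if i = j then 1 else 0))"

definition si_null :: "real \<Rightarrow> (real \<Rightarrow> real) set \<Rightarrow> bool" where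
  "si_null T B \<longleftrightarrow> (\<forall>\<rho>>0. scale_path \<rho> ` B \<in> null_sets (wm T))"

definition anw_ext :: "real \<Rightarrow> ((real \<Rightarrow> real) \<Rightarrow> complex) \<Rightarrow> (complex \<Rightarrow> complex) \<Rightarrow> bool" where
  "anw_ext T G J \<longleftrightarrow>
     (\<forall>l::real. l > 0 \<longrightarrow> integrable (wm T) (\<lambda>x. G (scale_path (1 / sqrt l) x))) \<and>
     J holomorphic_on {z. Re z > 0} \<and>
     (\<forall>l::real. l > 0 \<longrightarrow> J (complex_of_real l) = (\<integral>x. G (scale_path (1 / sqrt l) x) \<partial>wm T))"

definition anw_exists :: "real \<Rightarrow> ((real \<Rightarrow> real) \<Rightarrow> complex) \<Rightarrow> bool" where
  "anw_exists T G \<longleftrightarrow> (\<exists>J. anw_ext T G J)"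

definition anw :: "real \<Rightarrow> ((real \<Rightarrow> real) \<Rightarrow> complex) \<Rightarrow> complex \<Rightarrow> complex" where
  "anw T G lam = (SOME J. anw_ext T G J) lam"

definition T_lambda :: "real \<Rightarrow> complex \<Rightarrow> ((real \<Rightarrow> real) \<Rightarrow> complex) \<Rightarrow> (real \<Rightarrow> real) \<Rightarrow> complex" where
  "T_lambda T lam F y = anw T (\<lambda>x. F (add_path y x)) lam"

definition has_fft1 :: "real \<Rightarrow> real \<Rightarrow> ((real \<Rightarrow> real) \<Rightarrow> complex) \<Rightarrow> (real \<Rightarrow> real) \<Rightarrow> complex \<Rightarrow> bool" where
  "has_fft1 T q F y z \<longleftrightarrow>
     anw_exists T (\<lambda>x. F (add_path y x)) \<and>
     ((\<lambda>lam. T_lambda T lam F y) \<longlongrightarrow> z) (at (- \<i> * complex_of_real q) within {z. Re z > 0})"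

text \<open>(2s-1)!! with (-1)!! = 1.\<close>

definition odd_dfact :: "nat \<Rightarrow> nat" where
  "odd_dfact s = (\<Prod>k<s. 2 * k + 1)"

end

theory Submission
  imports Defs "HOL-Library.Discrete_Functions" "HOL-Complex_Analysis.Conformal_Mappings"
begin

text \<open>
  Wiener measure is obtained from the Levy--Ciesielski series, so that \<open>wiener T\<close> really has the Brownian
  property. Under it, Riemann--Stieltjes sums show that the integrals of the cosine basis are
  i.i.d. standard normal. Hence for \<open>v\<close> in \<open>L\<^sub>2\<close> the series defining \<open>\<langle>v, x\<rangle>\<close>
  converges for almost every \<open>x\<close>, and its domain of convergence is invariant under scaling. By
  Parseval for the cosine basis the variables \<open>\<langle>\<alpha>\<^sub>j, x\<rangle>\<close> are again i.i.d. standard normal. For \<open>y\<close> in the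
  domain of convergence,
  \<open>F (y + l\<^sup>-\<^sup>1\<^sup>/\<^sup>2 x)\<close> is almost surely a product of independent polynomials in Gaussians, whose
  expectation is a polynomial in \<open>1 / l\<close>. This extends holomorphically off \<open>0\<close>, uniquely on the right
  half-plane, and continuously to \<open>- \<i> q\<close>, where \<open>1 / l\<close> becomes \<open>\<i> / q\<close>.
\<close>

text \<open>Every random vector that matters below is an almost sure limit of linear combinations of
  independent normals. Independence together with normality is equivalent to a single identity for
  the joint characteristic function, and that identity survives almost sure limits by dominated
  convergence. This one device serves the Brownian increments, the cosine integrals and the PWZ
  integrals; only the computation of the limiting variance differs: a covariance expansion, a
  Riemann sum and Parseval's identity respectively. Defaults shape the rest. \<open>wiener T\<close>
  and \<open>anw\<close> are \<open>SOME\<close> terms: nothing is known about the first without an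
  existence proof, nor about the value of the second without a uniqueness proof. \<open>pwz\<close>
  is 0 where its series diverges, so additivity is available only on the domain of convergence. The
  exceptional set is therefore the set of divergence itself, which does not depend on q and serves
  for the integration variable as well as for y.\<close>

section \<open>Independence from characteristic functions\<close>

text \<open>The weight is normalised to a density, so that Levy uniqueness for probability measures applies.\<close>

lemma (in prob_space) weighted_char_unique_pos:
  fixes X :: "'a \<Rightarrow> real" and W :: "'a \<Rightarrow> real"
  assumes X[measurable]: "random_variable borel X" and W[measurable]: "W \<in> borel_measurable M"
    and pos: "\<And>x. 0 < W x" and bnd: "\<And>x. W x \<le> C"
    and eq: "\<And>u. (LINT x|M. complex_of_real (W x) * iexp (u * X x))
        = complex_of_real (LINT x|M. W x) * char (distr M borel X) u"
    and A[measurable]: "A \<in> sets borel"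
  shows "(LINT x|M. W x * indicator A (X x)) = (LINT x|M. W x) * prob (X -` A \<inter> space M)"
proof -
  have intW: "integrable M W"
    by (rule integrable_const_bound[where B=C]) (use pos bnd less_imp_le in \<open>auto simp: abs_of_pos\<close>)
  define c where "c = (LINT x|M. W x)"
  have "c > 0"
  proof -
    have "c \<ge> 0" unfolding c_def by (intro integral_nonneg_AE AE_I2 less_imp_le pos)
    moreover have "c \<noteq> 0"
    proof
      assume "c = 0"
      then have "AE x in M. W x = 0"
        using integral_nonneg_eq_0_iff_AE[OF intW] pos unfolding c_def by (auto intro: less_imp_le)
      then have "AE x in M. False" by eventually_elim (use pos in \<open>metis less_irrefl\<close>)
      then show False by simp
    qed
    ultimately show ?thesis by simp
  qed
  define N where "N = density M (\<lambda>x. ennreal (W x / c))"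
  have setsN[simp, measurable_cong]: "sets N = sets M" and spaceN[simp]: "space N = space M"
    by (auto simp: N_def)
  have "emeasure N (space N) = (\<integral>\<^sup>+x. ennreal (W x / c) \<partial>M)"
    by (auto simp: N_def emeasure_density intro!: nn_integral_cong)
  also have "\<dots> = ennreal (LINT x|M. W x / c)"
    using intW pos \<open>c > 0\<close> by (intro nn_integral_eq_integral AE_I2) (auto intro: less_imp_le)
  also have "\<dots> = 1" using \<open>c > 0\<close> by (simp add: c_def)
  finally interpret N: prob_space N by (rule prob_spaceI)
  have XN: "X \<in> borel_measurable N" by simp
  have intN: "(LINT x|N. f x) = (LINT x|M. (W x / c) *\<^sub>R f x)" if "f \<in> borel_measurable M"
    for f :: "'a \<Rightarrow> 'b::{banach,second_countable_topology}"
    unfolding N_def using pos \<open>c > 0\<close> that by (subst integral_density) (auto intro!: AE_I2 intro: less_imp_le)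
  have "char (distr N borel X) u = char (distr M borel X) u" for u
  proof -
    have "char (distr N borel X) u = (LINT x|N. iexp (u * X x))"
      unfolding char_def by (subst integral_distr) auto
    also have "\<dots> = (LINT x|M. (complex_of_real (W x) * iexp (u * X x)) / c)"
      by (subst intN) (auto simp: scaleR_conv_of_real)
    also have "\<dots> = char (distr M borel X) u"
      using \<open>c > 0\<close> unfolding c_def[symmetric] Bochner_Integration.integral_divide_zero eq by simp
    finally show ?thesis .
  qed
  then have D: "distr N borel X = distr M borel X"
    by (intro Levy_uniqueness N.real_distribution_distr real_distribution_distr ext) auto
  have "prob (X -` A \<inter> space M) = N.prob (X -` A \<inter> space M)"
    using D measure_distr[OF X A] measure_distr[OF XN A] by simp
  also have "\<dots> = (LINT x|N. indicator (X -` A \<inter> space M) x)"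
    by (subst Bochner_Integration.integral_indicator) auto
  also have "\<dots> = (LINT x|M. (W x * indicator A (X x)) / c)"
    by (subst intN) (auto intro!: Bochner_Integration.integral_cong simp: indicator_def)
  finally show ?thesis using \<open>c > 0\<close> by (simp add: c_def[symmetric])
qed

text \<open>Adding the constant C + 1 makes the weight positive. Hypothesis and conclusion are both
  linear in W and hold trivially for constant weights, so the constant can be removed again at the
  end.\<close>

lemma (in prob_space) weighted_char_unique_real:
  fixes X :: "'a \<Rightarrow> real" and W :: "'a \<Rightarrow> real"
  assumes X[measurable]: "random_variable borel X" and W[measurable]: "W \<in> borel_measurable M"
    and bnd: "\<And>x. \<bar>W x\<bar> \<le> C"
    and eq: "\<And>u. (LINT x|M. complex_of_real (W x) * iexp (u * X x))
        = complex_of_real (LINT x|M. W x) * char (distr M borel X) u"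
    and A[measurable]: "A \<in> sets borel"
  shows "(LINT x|M. W x * indicator A (X x)) = (LINT x|M. W x) * prob (X -` A \<inter> space M)"
proof -
  have intW: "integrable M W"
    by (rule integrable_const_bound[where B=C]) (use bnd in auto)
  have int1: "integrable M (\<lambda>x. complex_of_real (W x) * iexp (u * X x))" for u
    by (rule integrable_const_bound[where B=C]) (use bnd in \<open>auto simp: norm_mult\<close>)
  have int2: "integrable M (\<lambda>x. iexp (u * X x))" for u
    by (rule integrable_const_bound[where B=1]) auto
  have int3: "integrable M (\<lambda>x. W x * indicator A (X x))"
    by (rule integrable_const_bound[where B=C]) (use bnd in \<open>auto simp: indicator_def intro: order_trans[OF abs_ge_zero]\<close>)
  have int4: "integrable M (\<lambda>x. indicator A (X x) :: real)"
    by (rule integrable_const_bound[where B=1]) (auto simp: indicator_def)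
  have ch: "(LINT x|M. iexp (u * X x)) = char (distr M borel X) u" for u
    unfolding char_def by (subst integral_distr) auto
  let ?K = "C + 1"
  have "(LINT x|M. (W x + ?K) * indicator A (X x)) = (LINT x|M. W x + ?K) * prob (X -` A \<inter> space M)"
  proof (rule weighted_char_unique_pos[OF X _ _ _ _ A])
    show "0 < W x + ?K" for x using bnd[of x] by linarith
    show "W x + ?K \<le> 2 * C + 1" for x using bnd[of x] by linarith
    show "(LINT x|M. complex_of_real (W x + ?K) * iexp (u * X x))
        = complex_of_real (LINT x|M. W x + ?K) * char (distr M borel X) u" for u
    proof -
      have "(LINT x|M. complex_of_real (W x + ?K) * iexp (u * X x))
        = (LINT x|M. complex_of_real (W x) * iexp (u * X x) + complex_of_real ?K * iexp (u * X x))"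
        by (simp add: ring_distribs)
      also have "\<dots> = (LINT x|M. complex_of_real (W x) * iexp (u * X x)) + complex_of_real ?K * (LINT x|M. iexp (u * X x))"
        using int1 int2 by (subst Bochner_Integration.integral_add) auto
      also have "\<dots> = complex_of_real (LINT x|M. W x + ?K) * char (distr M borel X) u"
        unfolding eq ch using intW by (simp add: prob_space ring_distribs)
      finally show ?thesis .
    qed
  qed simp
  also have "(LINT x|M. (W x + ?K) * indicator A (X x)) = (LINT x|M. W x * indicator A (X x)) + ?K * prob (X -` A \<inter> space M)"
  proof -
    have "(LINT x|M. indicator A (X x) :: real) = (LINT x|M. indicator (X -` A \<inter> space M) x)"
      by (rule Bochner_Integration.integral_cong) (auto simp: indicator_def)
    also have "\<dots> = prob (X -` A \<inter> space M)"
      by (subst Bochner_Integration.integral_indicator) auto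
    finally have *: "(LINT x|M. indicator A (X x) :: real) = prob (X -` A \<inter> space M)" .
    have "(LINT x|M. (W x + ?K) * indicator A (X x)) = (LINT x|M. W x * indicator A (X x) + ?K * indicator A (X x))"
      by (simp add: ring_distribs)
    then show ?thesis using int3 int4 * by simp
  qed
  finally show ?thesis using intW by (simp add: prob_space ring_distribs)
qed

text \<open>The hypothesis is stable under conjugation: conjugating it at -u gives it for
  \<open>cnj (W x)\<close>, because a characteristic function at -u is the conjugate of its value at
  u. Hence it passes to real and imaginary parts.\<close>

lemma (in prob_space) weighted_char_unique:
  fixes X :: "'a \<Rightarrow> real" and W :: "'a \<Rightarrow> complex"
  assumes X[measurable]: "random_variable borel X" and W[measurable]: "W \<in> borel_measurable M"
    and bnd: "\<And>x. norm (W x) \<le> C"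
    and eq: "\<And>u. (LINT x|M. W x * iexp (u * X x)) = (LINT x|M. W x) * char (distr M borel X) u"
    and A[measurable]: "A \<in> sets borel"
  shows "(LINT x|M. W x * indicator A (X x)) = (LINT x|M. W x) * prob (X -` A \<inter> space M)"
proof -
  have intW: "integrable M W"
    by (rule integrable_const_bound[where B=C]) (use bnd in auto)
  have int1: "integrable M (\<lambda>x. W x * iexp (u * X x))" for u
    by (rule integrable_const_bound[where B=C]) (use bnd in \<open>auto simp: norm_mult\<close>)
  have [measurable]: "(\<lambda>x. cnj (W x)) \<in> borel_measurable M"
    by (rule measurable_compose[OF W borel_measurable_continuous_onI]) (intro continuous_intros)
  have int1': "integrable M (\<lambda>x. cnj (W x) * iexp (u * X x))" for u
    by (rule integrable_const_bound[where B=C]) (use bnd in \<open>auto simp: norm_mult\<close>)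
  have int3: "integrable M (\<lambda>x. W x * indicator A (X x))"
    by (rule integrable_const_bound[where B=C]) (use bnd in \<open>auto simp: indicator_def intro: order_trans[OF norm_ge_zero]\<close>)
  have chm: "cnj (char (distr M borel X) (- u)) = char (distr M borel X) u" for u
  proof -
    have "cnj (char (distr M borel X) (- u)) = (LINT x|distr M borel X. cnj (iexp (- u * x)))"
      unfolding char_def by simp
    also have "\<dots> = char (distr M borel X) u" unfolding char_def by (simp add: exp_cnj)
    finally show ?thesis .
  qed
  have eq': "(LINT x|M. cnj (W x) * iexp (u * X x)) = (LINT x|M. cnj (W x)) * char (distr M borel X) u" for u
  proof -
    have "(LINT x|M. cnj (W x) * iexp (u * X x)) = (LINT x|M. cnj (W x * iexp (- u * X x)))"
      by (simp add: exp_cnj)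
    also have "\<dots> = cnj (LINT x|M. W x * iexp (- u * X x))" by (rule Bochner_Integration.integral_cnj)
    also have "\<dots> = (LINT x|M. cnj (W x)) * char (distr M borel X) u"
      by (subst eq) (simp add: chm)
    finally show ?thesis .
  qed
  have R: "(LINT x|M. Re (W x) * indicator A (X x)) = (LINT x|M. Re (W x)) * prob (X -` A \<inter> space M)"
  proof (rule weighted_char_unique_real[OF X _ _ _ A])
    show "\<bar>Re (W x)\<bar> \<le> C" for x using bnd[of x] abs_Re_le_cmod[of "W x"] by linarith
    fix u
    have "(LINT x|M. complex_of_real (Re (W x)) * iexp (u * X x))
       = (LINT x|M. (W x * iexp (u * X x) + cnj (W x) * iexp (u * X x)) / 2)"
      by (intro Bochner_Integration.integral_cong refl) (simp add: complex_add_cnj flip: distrib_right)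
    also have "\<dots> = ((LINT x|M. W x) * char (distr M borel X) u + (LINT x|M. cnj (W x)) * char (distr M borel X) u) / 2"
      unfolding Bochner_Integration.integral_divide_zero Bochner_Integration.integral_add[OF int1 int1'] eq eq' ..
    also have "\<dots> = complex_of_real (LINT x|M. Re (W x)) * char (distr M borel X) u"
      using intW by (simp add: complex_add_cnj flip: distrib_right)
    finally show "(LINT x|M. complex_of_real (Re (W x)) * iexp (u * X x))
        = complex_of_real (LINT x|M. Re (W x)) * char (distr M borel X) u" .
  qed simp
  have im_part: "complex_of_real (Im w) * e = (w * e - cnj w * e) / (2 * \<i>)" for w e :: complex
  proof -
    have "w * e - cnj w * e = complex_of_real (Im w) * e * (2 * \<i>)"
      by (simp add: complex_diff_cnj flip: left_diff_distrib)
    then show ?thesis by (metis nonzero_mult_div_cancel_right complex_i_not_zero no_zero_divisors zero_neq_numeral)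
  qed
  have I: "(LINT x|M. Im (W x) * indicator A (X x)) = (LINT x|M. Im (W x)) * prob (X -` A \<inter> space M)"
  proof (rule weighted_char_unique_real[OF X _ _ _ A])
    show "\<bar>Im (W x)\<bar> \<le> C" for x using bnd[of x] abs_Im_le_cmod[of "W x"] by linarith
    fix u
    have "(LINT x|M. complex_of_real (Im (W x)) * iexp (u * X x))
       = (LINT x|M. (W x * iexp (u * X x) - cnj (W x) * iexp (u * X x)) / (2 * \<i>))"
      by (intro Bochner_Integration.integral_cong refl) (rule im_part)
    also have "\<dots> = ((LINT x|M. W x) * char (distr M borel X) u - (LINT x|M. cnj (W x)) * char (distr M borel X) u) / (2 * \<i>)"
      unfolding Bochner_Integration.integral_divide_zero Bochner_Integration.integral_diff[OF int1 int1'] eq eq' ..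
    also have "\<dots> = complex_of_real (LINT x|M. Im (W x)) * char (distr M borel X) u"
      using intW unfolding Bochner_Integration.integral_cnj by (simp only: integral_Im im_part)
    finally show "(LINT x|M. complex_of_real (Im (W x)) * iexp (u * X x))
        = complex_of_real (LINT x|M. Im (W x)) * char (distr M borel X) u" .
  qed simp
  show ?thesis
  proof (rule complex_eqI)
    have "Re (LINT x|M. W x * indicator A (X x)) = (LINT x|M. Re (W x * indicator A (X x)))"
      by (rule integral_Re[OF int3, symmetric])
    also have "\<dots> = (LINT x|M. Re (W x) * indicator A (X x))"
      by (rule Bochner_Integration.integral_cong) (auto simp: indicator_def)
    finally show "Re (LINT x|M. W x * indicator A (X x)) = Re ((LINT x|M. W x) * prob (X -` A \<inter> space M))"
      using R intW by simp
    have "Im (LINT x|M. W x * indicator A (X x)) = (LINT x|M. Im (W x * indicator A (X x)))"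
      by (rule integral_Im[OF int3, symmetric])
    also have "\<dots> = (LINT x|M. Im (W x) * indicator A (X x))"
      by (rule Bochner_Integration.integral_cong) (auto simp: indicator_def)
    finally show "Im (LINT x|M. W x * indicator A (X x)) = Im ((LINT x|M. W x) * prob (X -` A \<inter> space M))"
      using I intW by simp
  qed
qed

text \<open>Reduction to one-dimensional uniqueness: the exponentials are traded for
  indicators one variable at a time, the remaining factors being absorbed into a complex weight.\<close>

theorem (in prob_space) indep_vars_if_char_factors:
  fixes X :: "nat \<Rightarrow> 'a \<Rightarrow> real"
  assumes rv: "\<And>i. i < k \<Longrightarrow> random_variable borel (X i)"
    and eq: "\<And>u. (LINT x|M. iexp (\<Sum>i<k. u i * X i x)) = (\<Prod>i<k. char (distr M borel (X i)) (u i))"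
  shows "indep_vars (\<lambda>_. borel) X {..<k}"
proof (cases "k = 0")
  case True
  \<comment> \<open>Kept apart because the intersection used below, over an empty index set, would
    be \<open>UNIV\<close> instead of \<open>space M\<close>.\<close>
  then show ?thesis by (auto simp: indep_vars_def indep_sets_def)
next
  case False
  let ?\<phi> = "\<lambda>i. char (distr M borel (X i))"
  \<comment> \<open>For m = 0 this is the hypothesis; for m = k and u = 0 it is the product rule for
    probabilities.\<close>
  have claim: "(LINT x|M. (\<Prod>i<m. indicator (A i) (X i x)) * iexp (\<Sum>i\<in>{m..<k}. u i * X i x))
      = (\<Prod>i<m. complex_of_real (prob (X i -` A i \<inter> space M))) * (\<Prod>i\<in>{m..<k}. ?\<phi> i (u i))"
    if "m \<le> k" "\<And>i. i < m \<Longrightarrow> A i \<in> sets borel" for m A u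
    using that
  proof (induction m arbitrary: u)
    case 0
    then show ?case using eq[of u] by (simp add: atLeast0LessThan)
  next
    case (Suc m)
    have [measurable]: "random_variable borel (X i)" if "i < k" for i using rv that .
    have [measurable]: "A i \<in> sets borel" if "i < Suc m" for i using Suc.prems that by auto
    define W where "W = (\<lambda>x. (\<Prod>i<m. indicator (A i) (X i x)) * iexp (\<Sum>i\<in>{Suc m..<k}. u i * X i x))"
    have Wm: "W \<in> borel_measurable M"
      unfolding W_def using Suc.prems
      by (intro borel_measurable_times borel_measurable_prod borel_measurable_indicator'
          measurable_compose[OF _ borel_measurable_exp] borel_measurable_of_real borel_measurable_sum) auto
    have mk: "m < k" using Suc.prems by simp
    have split: "{m..<k} = insert m {Suc m..<k}" using mk by auto
    have IH: "(LINT x|M. W x * iexp (t * X m x))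
        = (\<Prod>i<m. complex_of_real (prob (X i -` A i \<inter> space M))) * (?\<phi> m t * (\<Prod>i\<in>{Suc m..<k}. ?\<phi> i (u i)))" for t
    proof -
      have "(LINT x|M. W x * iexp (t * X m x)) = (LINT x|M. (\<Prod>i<m. indicator (A i) (X i x)) * iexp (\<Sum>i\<in>{m..<k}. (u(m := t)) i * X i x))"
        by (intro Bochner_Integration.integral_cong refl)
          (simp add: W_def split exp_add ring_distribs)
      also have "\<dots> = (\<Prod>i<m. complex_of_real (prob (X i -` A i \<inter> space M))) * (\<Prod>i\<in>{m..<k}. ?\<phi> i ((u(m := t)) i))"
        using Suc.prems by (intro Suc.IH) auto
      finally show ?thesis by (simp add: split)
    qed
    \<comment> \<open>At t = 0 the induction hypothesis yields the mean of \<open>W\<close>, which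
      the one-dimensional uniqueness lemma has on its other side.\<close>
    have ph0: "?\<phi> m 0 = 1"
      using rv[OF mk] by (intro real_distribution.char_zero) auto
    have W0: "(LINT x|M. W x) = (\<Prod>i<m. complex_of_real (prob (X i -` A i \<inter> space M))) * (\<Prod>i\<in>{Suc m..<k}. ?\<phi> i (u i))"
      using IH[of 0] ph0 by simp
    have "(LINT x|M. W x * indicator (A m) (X m x)) = (LINT x|M. W x) * prob (X m -` A m \<inter> space M)"
    proof (rule weighted_char_unique[OF rv[OF mk] Wm])
      show "norm (W x) \<le> 1" for x
      proof -
        have "norm (\<Prod>i<m. indicator (A i) (X i x) :: complex) \<le> (\<Prod>i<m. 1)"
          unfolding prod_norm[symmetric] by (intro prod_mono) (auto simp: indicator_def)
        then show ?thesis by (simp add: W_def norm_mult)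
      qed
      show "(LINT x|M. W x * iexp (t * X m x)) = (LINT x|M. W x) * ?\<phi> m t" for t
        unfolding IH W0 by simp
    qed (use Suc.prems in auto)
    moreover have "(LINT x|M. W x * indicator (A m) (X m x)) = (LINT x|M. (\<Prod>i<Suc m. indicator (A i) (X i x)) * iexp (\<Sum>i\<in>{Suc m..<k}. u i * X i x))"
      by (intro Bochner_Integration.integral_cong refl) (simp add: W_def)
    ultimately show ?case by (simp add: W0)
  qed
  show ?thesis
  proof (subst indep_vars_finite[where E="\<lambda>_. sets borel"])
    show "\<forall>A\<in>{..<k} \<rightarrow> sets borel. prob (\<Inter>j\<in>{..<k}. X j -` A j \<inter> space M) = (\<Prod>j<k. prob (X j -` A j \<inter> space M))"
    proof
      fix A assume A: "A \<in> {..<k} \<rightarrow> (sets borel :: real set set)"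
      let ?S = "\<Inter>j\<in>{..<k}. X j -` A j \<inter> space M"
      have S: "?S \<in> events"
        using A rv False by (intro sets.finite_INT) (auto intro: measurable_sets)
      have "(\<Prod>i<k. indicator (A i) (X i x)) * iexp (\<Sum>i\<in>{k..<k}. 0 * X i x) = complex_of_real (indicator ?S x)" if sx: "x \<in> space M" for x
      proof (cases "x \<in> ?S")
        case True
        then have "(\<Prod>i<k. indicator (A i) (X i x) :: complex) = 1"
          using False by (intro prod.neutral) (auto simp: indicator_def split: if_splits)
        then show ?thesis using True by simp
      next
        case F: False
        then obtain j where "j < k" "X j x \<notin> A j" using sx by (auto split: if_splits)
        then have "(\<Prod>i<k. indicator (A i) (X i x) :: complex) = 0"
          by (intro prod_zero) (auto simp: indicator_def)
        then show ?thesis using F by (auto simp: indicator_def)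
      qed
      then have "(LINT x|M. complex_of_real (indicator ?S x)) = (LINT x|M. (\<Prod>i<k. indicator (A i) (X i x)) * iexp (\<Sum>i\<in>{k..<k}. 0 * X i x))"
        by (intro Bochner_Integration.integral_cong refl) (rule sym)
      also have "\<dots> = (\<Prod>i<k. complex_of_real (prob (X i -` A i \<inter> space M)))"
        using claim[of k A "\<lambda>_. 0"] A by auto
      finally have "(LINT x|M. complex_of_real (indicator ?S x)) = (\<Prod>i<k. complex_of_real (prob (X i -` A i \<inter> space M)))" .
      then have "complex_of_real (LINT x|M. indicator ?S x) = complex_of_real (\<Prod>i<k. (prob (X i -` A i \<inter> space M)))"
        by simp
      then have "(LINT x|M. indicator ?S x) = (\<Prod>i<k. (prob (X i -` A i \<inter> space M)))"
        using of_real_eq_iff by blast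
      then show "prob ?S = (\<Prod>i<k. (prob (X i -` A i \<inter> space M)))"
        using S by (subst (asm) Bochner_Integration.integral_indicator) auto
    qed
  qed (use rv False in \<open>auto simp: sets.sigma_sets_eq[of borel, simplified] Int_stable_def\<close>)
qed

section \<open>Gaussian families recognised by their characteristic functions\<close>

lemma (in prob_space) normal_if_char:
  fixes X :: "'a \<Rightarrow> real"
  assumes X[measurable]: "random_variable borel X" and s: "\<sigma> > 0"
    and eq: "\<And>u. (LINT x|M. iexp (u * X x)) = complex_of_real (exp (- (u * \<sigma>)\<^sup>2 / 2))"
  shows "distributed M lborel X (normal_density 0 \<sigma>)"
proof -
  have "distr M borel (\<lambda>x. X x / \<sigma>) = std_normal_distribution"
  proof (rule Levy_uniqueness[OF real_distribution_distr real_dist_normal_dist])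
    show "char (distr M borel (\<lambda>x. X x / \<sigma>)) = char std_normal_distribution"
    proof
      fix u
      have "char (distr M borel (\<lambda>x. X x / \<sigma>)) u = (LINT x|M. iexp ((u / \<sigma>) * X x))"
        unfolding char_def by (subst integral_distr) auto
      then show "char (distr M borel (\<lambda>x. X x / \<sigma>)) u = char std_normal_distribution u"
        unfolding eq char_std_normal_distribution using s by simp
    qed
  qed simp
  then have "distributed M lborel (\<lambda>x. (X x - 0) / \<sigma>) std_normal_density"
    unfolding distributed_def by (auto cong: distr_cong)
  then show ?thesis using normal_standard_normal_convert[OF s, of X 0] by simp
qed

lemma (in prob_space) char_normal:
  fixes X :: "'a \<Rightarrow> real"
  assumes s: "\<sigma> > 0" and d: "distributed M lborel X (normal_density 0 \<sigma>)"
  shows "(LINT x|M. iexp (u * X x)) = complex_of_real (exp (- (u * \<sigma>)\<^sup>2 / 2))"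
proof -
  have X[measurable]: "random_variable borel X" using distributed_measurable[OF d] by simp
  have "distributed M lborel (\<lambda>x. X x / \<sigma>) std_normal_density"
    using d normal_standard_normal_convert[OF s, of X 0] by simp
  then have D: "distr M borel (\<lambda>x. X x / \<sigma>) = std_normal_distribution"
    unfolding distributed_def by (metis distr_cong sets_lborel)
  have "(LINT x|M. iexp (u * X x)) = char (distr M borel (\<lambda>x. X x / \<sigma>)) (u * \<sigma>)"
    unfolding char_def using s by (subst integral_distr) auto
  then show ?thesis by (simp add: D char_std_normal_distribution)
qed

lemma (in prob_space) char_indep_normal:
  fixes X :: "'i \<Rightarrow> 'a \<Rightarrow> real"
  assumes fin: "finite I" and s: "\<And>i. i \<in> I \<Longrightarrow> \<sigma> i > 0" 
    and ind: "indep_vars (\<lambda>_. borel) X I"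
    and d: "\<And>i. i \<in> I \<Longrightarrow> distributed M lborel (X i) (normal_density 0 (\<sigma> i))"
  shows "(LINT x|M. iexp (\<Sum>i\<in>I. c i * X i x)) = complex_of_real (exp (- (\<Sum>i\<in>I. (c i * \<sigma> i)\<^sup>2) / 2))"
proof -
  have rv: "random_variable borel (X i)" if "i \<in> I" for i using distributed_measurable[OF d[OF that]] by simp
  have ind': "indep_vars (\<lambda>_. borel) (\<lambda>i x. iexp (c i * X i x)) I"
    by (rule indep_vars_compose2[OF ind]) measurable
  have "(LINT x|M. iexp (\<Sum>i\<in>I. c i * X i x)) = (LINT x|M. (\<Prod>i\<in>I. iexp (c i * X i x)))"
    using fin by (simp add: exp_sum sum_distrib_left)
  also have "\<dots> = (\<Prod>i\<in>I. (LINT x|M. iexp (c i * X i x)))"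
    using rv by (intro indep_vars_lebesgue_integral[OF fin ind'] integrable_iexp) auto
  also have "\<dots> = (\<Prod>i\<in>I. complex_of_real (exp (- (c i * \<sigma> i)\<^sup>2 / 2)))"
    by (intro prod.cong refl char_normal s d)
  also have "\<dots> = complex_of_real (exp (- (\<Sum>i\<in>I. (c i * \<sigma> i)\<^sup>2) / 2))"
    using fin by (simp add: exp_sum sum_negf[symmetric] sum_divide_distrib)
  finally show ?thesis .
qed

text \<open>Switching off all but one u i identifies the marginals, after which the given formula is
  the product of the marginal characteristic functions. Used for the Brownian increments, the cosine
  integrals and the PWZ integrals.\<close>

lemma (in prob_space) indep_normal_if_char:
  fixes X :: "nat \<Rightarrow> 'a \<Rightarrow> real"
  assumes rv: "\<And>i. i < k \<Longrightarrow> random_variable borel (X i)" and s: "\<And>i. i < k \<Longrightarrow> \<sigma> i > 0" 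
    and eq: "\<And>u. (LINT x|M. iexp (\<Sum>i<k. u i * X i x)) = complex_of_real (exp (- (\<Sum>i<k. (u i * \<sigma> i)\<^sup>2) / 2))"
  shows "indep_vars (\<lambda>_. borel) X {..<k}"
    and "\<And>i. i < k \<Longrightarrow> distributed M lborel (X i) (normal_density 0 (\<sigma> i))"
proof -
  have one: "(LINT x|M. iexp (t * X i x)) = complex_of_real (exp (- (t * \<sigma> i)\<^sup>2 / 2))" if "i < k" for i t
  proof -
    have *: "(\<Sum>j<k. (if j = i then t else 0) * X j x) = t * X i x" for x
      using that by (subst sum.cong[OF refl, where h="\<lambda>j. if j = i then t * X i x else 0"]) auto
    have **: "(\<Sum>j<k. ((if j = i then t else 0) * \<sigma> j)\<^sup>2) = (t * \<sigma> i)\<^sup>2"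
      using that by (subst sum.cong[OF refl, where h="\<lambda>j. if j = i then (t * \<sigma> i)\<^sup>2 else 0"]) auto
    show ?thesis using eq[of "\<lambda>j. if j = i then t else 0"] unfolding * ** .
  qed
  show "distributed M lborel (X i) (normal_density 0 (\<sigma> i))" if "i < k" for i
    using that by (intro normal_if_char rv s one)
  have ch: "char (distr M borel (X i)) t = complex_of_real (exp (- (t * \<sigma> i)\<^sup>2 / 2))" if "i < k" for i t
    unfolding one[OF that, symmetric] char_def using rv[OF that] by (subst integral_distr) auto
  show "indep_vars (\<lambda>_. borel) X {..<k}"
  proof (rule indep_vars_if_char_factors[OF rv])
    fix u
    show "(LINT x|M. iexp (\<Sum>i<k. u i * X i x)) = (\<Prod>i<k. char (distr M borel (X i)) (u i))"
      unfolding eq by (simp add: ch exp_sum sum_negf[symmetric] sum_divide_distrib)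
  qed
qed

text \<open>Complex exponentials of real arguments are bounded by 1, so no moment bound on the Y n
  is called for; besides almost sure convergence only the variances have to converge.\<close>

lemma (in prob_space) char_limit:
  fixes Y :: "nat \<Rightarrow> 'a \<Rightarrow> real"
  assumes Y[measurable]: "\<And>n. random_variable borel (Y n)" and Z[measurable]: "random_variable borel Z"
    and conv: "AE x in M. (\<lambda>n. Y n x) \<longlonglongrightarrow> Z x"
    and eq: "\<And>n. (LINT x|M. iexp (Y n x)) = complex_of_real (exp (- v n / 2))"
    and v: "v \<longlonglongrightarrow> V"
  shows "(LINT x|M. iexp (Z x)) = complex_of_real (exp (- V / 2))"
proof (rule LIMSEQ_unique)
  show "(\<lambda>n. (LINT x|M. iexp (Y n x))) \<longlonglongrightarrow> (LINT x|M. iexp (Z x))"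
  proof (rule integral_dominated_convergence[where w="\<lambda>_. 1"])
    show "AE x in M. (\<lambda>n. iexp (Y n x)) \<longlonglongrightarrow> iexp (Z x)"
      using conv by eventually_elim (intro tendsto_intros)
  qed auto
  show "(\<lambda>n. (LINT x|M. iexp (Y n x))) \<longlonglongrightarrow> complex_of_real (exp (- V / 2))"
    unfolding eq by (intro tendsto_intros v) auto
qed

section \<open>The Levy--Ciesielski series\<close>

definition tent :: "real \<Rightarrow> real" where
  "tent s = max 0 (1 - \<bar>2 * s - 1\<bar>)"

text \<open>The covariance vanishes on the boundary of the unit square, so the extension by zero
  lets rescaled copies be added over all dyadic cells; shared endpoints contribute nothing
  twice.\<close>

definition bridge_cov :: "real \<Rightarrow> real \<Rightarrow> real" where
  "bridge_cov s t = (if s \<in> {0..1} \<and> t \<in> {0..1} then min s t - s * t else 0)"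

text \<open>Primitives of the Haar functions, where m = 2^n + k codes level n and position k. A Haar
  function of level n has height 2^(n/2) on a half-support of length 2^-(n+1), whence the peak 1 /
  sqrt (2^(n+2)).\<close>

definition schauder :: "nat \<Rightarrow> real \<Rightarrow> real" where
  "schauder m t = (if m = 0 then t
     else tent (2 ^ floor_log m * t - real (m - 2 ^ floor_log m)) / sqrt (2 ^ (floor_log m + 2)))"

text \<open>Self-similarity of the Brownian bridge covariance; iterating it replaces completeness of the Haar system.\<close>

lemma bridge_cov_rec:
  "bridge_cov s t = tent s * tent t / 4 + (bridge_cov (2 * s) (2 * t) + bridge_cov (2 * s - 1) (2 * t - 1)) / 2"
proof (cases "s \<in> {0..1} \<and> t \<in> {0..1}")
  case True
  then have st: "0 \<le> s" "s \<le> 1" "0 \<le> t" "t \<le> 1" by auto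
  have T: "tent x = (if x \<le> 1/2 then 2 * x else 2 - 2 * x)" if "0 \<le> x" "x \<le> 1" for x
    using that by (auto simp: tent_def)
  show ?thesis
  proof (cases "s = 1/2 \<and> t = 1/2")
    case False
    then show ?thesis
      using st by (auto simp: T bridge_cov_def min_def) (simp_all add: field_simps)
  next
    case True
    then have "s = 1/2" "t = 1/2" by auto
    then show ?thesis by (simp only:) (simp add: T bridge_cov_def)
  qed
next
  case False
  then consider "s < 0" | "s > 1" | "t < 0" | "t > 1" by fastforce
  then show ?thesis by cases (auto simp: tent_def bridge_cov_def)
qed

lemma sum_lessThan_double:
  fixes f :: "nat \<Rightarrow> 'a::comm_monoid_add"
  shows "(\<Sum>k<2 * m. f k) = (\<Sum>k<m. f (2 * k) + f (2 * k + 1))"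
  by (induction m) (auto simp: algebra_simps)

text \<open>The sum over n is the share of the Schauder functions of positive index in the
  covariance expansion, so the last term is exactly the error after N levels.\<close>

lemma bridge_cov_iterate:
  "bridge_cov s t = (\<Sum>n<N. (\<Sum>k<2^n. tent (2^n * s - real k) * tent (2^n * t - real k)) / 2^(n + 2))
     + (\<Sum>k<2^N. bridge_cov (2^N * s - real k) (2^N * t - real k)) / 2^N"
proof (induction N)
  case 0
  then show ?case by simp
next
  case (Suc N)
  have "(\<Sum>k<2^N. bridge_cov (2^N * s - real k) (2^N * t - real k))
    = (\<Sum>k<2^N. tent (2^N * s - real k) * tent (2^N * t - real k) / 4
        + (bridge_cov (2^Suc N * s - real (2 * k)) (2^Suc N * t - real (2 * k))
        + bridge_cov (2^Suc N * s - real (2 * k + 1)) (2^Suc N * t - real (2 * k + 1))) / 2)"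
    by (intro sum.cong refl, subst bridge_cov_rec) (simp add: algebra_simps)
  also have "\<dots> = (\<Sum>k<2^N. tent (2^N * s - real k) * tent (2^N * t - real k)) / 4
        + (\<Sum>k<2^Suc N. bridge_cov (2^Suc N * s - real k) (2^Suc N * t - real k)) / 2"
    unfolding power_Suc[of "2::nat"] sum_lessThan_double
    by (simp only: sum.distrib sum_divide_distrib[symmetric])
  finally show ?case using Suc.IH by (simp add: field_simps)
qed

lemma tent_nonneg: "0 \<le> tent x" and tent_le_1: "tent x \<le> 1"
  by (auto simp: tent_def)

text \<open>The tents have disjoint open supports: at a only the translate by the integer part of a
  can be nonzero.\<close>

lemma sum_tent_le_1: "(\<Sum>k<m. tent (a - real k)) \<le> 1"
proof -
  have "tent (a - real k) \<le> (if k = nat \<lfloor>a\<rfloor> then 1 else 0)" for k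
  proof (cases "k = nat \<lfloor>a\<rfloor>")
    case False
    have "a - real k \<le> 0 \<or> a - real k \<ge> 1"
    proof (rule ccontr)
      assume "\<not> (a - real k \<le> 0 \<or> a - real k \<ge> 1)"
      then have "\<lfloor>a\<rfloor> = int k" by (intro floor_unique) auto
      then show False using False by simp
    qed
    then show ?thesis using False by (auto simp: tent_def)
  qed (simp add: tent_le_1)
  then have "(\<Sum>k<m. tent (a - real k)) \<le> (\<Sum>k<m. (if k = nat \<lfloor>a\<rfloor> then 1 else 0))"
    by (intro sum_mono)
  also have "\<dots> \<le> 1" by simp
  finally show ?thesis .
qed

text \<open>A tent instead of a constant as bound: the 2^N rescaled copies in the remainder then add
  up to at most 1, and the prefactor 2^-N drives it to zero.\<close>

lemma bridge_cov_bound: "\<bar>bridge_cov s t\<bar> \<le> tent s"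
proof (cases "s \<in> {0..1} \<and> t \<in> {0..1}")
  case True
  then have st: "0 \<le> s" "s \<le> 1" "0 \<le> t" "t \<le> 1" by auto
  have 1: "0 \<le> s * (1 - t)" "s * (1 - t) \<le> s" "0 \<le> t * (1 - s)" "t * (1 - s) \<le> 1 - s"
    using st by (auto simp: mult_left_le mult_left_le_one_le)
  have "min s t - s * t = min (s * (1 - t)) (t * (1 - s))"
    by (auto simp: min_def algebra_simps)
  then have "0 \<le> min s t - s * t" "min s t - s * t \<le> s" "min s t - s * t \<le> 1 - s"
    using 1 by auto
  then show ?thesis using True st by (auto simp: bridge_cov_def tent_def)
qed (auto simp: bridge_cov_def tent_nonneg)

lemma schauder_0: "schauder 0 t = t"
  by (simp add: schauder_def)

lemma schauder_level: "k < 2 ^ n \<Longrightarrow> schauder (2 ^ n + k) t = tent (2 ^ n * t - real k) / sqrt (2 ^ (n + 2))"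
proof -
  assume "k < 2 ^ n"
  then have "floor_log (2 ^ n + k) = n" by (intro floor_log_eqI) auto
  then show ?thesis by (simp add: schauder_def)
qed

lemma sum_lessThan_dyadic:
  fixes f :: "nat \<Rightarrow> 'a::comm_monoid_add"
  shows "(\<Sum>m<2^N. f m) = f 0 + (\<Sum>n<N. \<Sum>k<2^n. f (2^n + k))"
proof (induction N)
  case (Suc N)
  have "(\<Sum>m<2^Suc N. f m) = (\<Sum>m<2^N. f m) + (\<Sum>k<2^N. f (2^N + k))"
    using sum.atLeastLessThan_concat[of 0 "2^N" "2^N + 2^N" f] sum.shift_bounds_nat_ivl[of f 0 "2^N" "2^N"]
    by (simp add: mult_2 atLeast0LessThan add.commute)
  then show ?case using Suc by (simp add: add_ac)
qed simp

text \<open>\<open>schauder 0\<close> contributes s * t, which turns the covariance of the bridge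
  into that of Brownian motion.\<close>

lemma schauder_cov:
  assumes "s \<in> {0..1}" "t \<in> {0..1}"
  shows "(\<lambda>N. \<Sum>m<2^N. schauder m s * schauder m t) \<longlonglongrightarrow> min s t"
proof -
  define R where "R N = (\<Sum>k<2^N. bridge_cov (2^N * s - real k) (2^N * t - real k)) / 2^N" for N
  have "(\<Sum>m<2^N. schauder m s * schauder m t) = s * t + (bridge_cov s t - R N)" for N
  proof -
    have "(\<Sum>k<2^n. schauder (2^n + k) s * schauder (2^n + k) t) = (\<Sum>k<2^n. tent (2^n * s - real k) * tent (2^n * t - real k)) / 2^(n + 2)" for n
      unfolding sum_divide_distrib
    proof (intro sum.cong refl)
      fix k :: nat assume "k \<in> {..<2 ^ n}"
      then have k: "k < 2 ^ n" by simp
      have "sqrt (2 ^ (n + 2)) * sqrt (2 ^ (n + 2)) = (2 ^ (n + 2) :: real)"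
        by (rule real_sqrt_mult_self[THEN trans]) simp
      then show "schauder (2^n + k) s * schauder (2^n + k) t = tent (2^n * s - real k) * tent (2^n * t - real k) / 2^(n + 2)"
        unfolding schauder_level[OF k] times_divide_times_eq by (simp only:)
    qed
    then have "(\<Sum>m<2^N. schauder m s * schauder m t) = s * t + (\<Sum>n<N. (\<Sum>k<2^n. tent (2^n * s - real k) * tent (2^n * t - real k)) / 2^(n + 2))"
      by (subst sum_lessThan_dyadic) (simp add: schauder_0)
    then show ?thesis using bridge_cov_iterate[of s t N] by (simp add: R_def)
  qed
  moreover have "R \<longlonglongrightarrow> 0"
  proof (rule Lim_null_comparison)
    have "\<bar>R N\<bar> \<le> (1/2)^N" for N
    proof -
      have "\<bar>\<Sum>k<2^N. bridge_cov (2^N * s - real k) (2^N * t - real k)\<bar> \<le> (\<Sum>k<2^N. tent (2^N * s - real k))"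
        by (intro order_trans[OF sum_abs] sum_mono bridge_cov_bound)
      also have "\<dots> \<le> 1" by (rule sum_tent_le_1)
      finally show ?thesis by (simp add: R_def power_divide divide_right_mono)
    qed
    then show "\<forall>\<^sub>F N in sequentially. norm (R N) \<le> (1/2)^N" by simp
  qed (rule LIMSEQ_power_zero, simp)
  ultimately have "(\<lambda>N. \<Sum>m<2^N. schauder m s * schauder m t) \<longlonglongrightarrow> s * t + (bridge_cov s t - 0)"
    by (simp only:) (intro tendsto_intros)
  then show ?thesis using assms by (simp add: bridge_cov_def)
qed

section \<open>Uniform convergence of the random series\<close>

definition level :: "(nat \<Rightarrow> real) \<Rightarrow> nat \<Rightarrow> real \<Rightarrow> real" where
  "level \<omega> n t = (\<Sum>k<2^n. \<omega> (2^n + k) * schauder (2^n + k) t)"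

text \<open>A fourth moment suffices: the base 3 lies below 4, which makes the levels of a tame sequence
  geometrically small, and above 2, which makes almost every Gaussian sequence tame.\<close>

definition tame :: "(nat \<Rightarrow> real) \<Rightarrow> bool" where
  "tame \<omega> \<longleftrightarrow> (\<Sum>n. ennreal ((\<Sum>k<2^n. \<omega> (2^n + k) ^ 4) / 3 ^ n)) \<noteq> \<infinity>"

text \<open>Tents of one level do not overlap, so a level is bounded by its largest scaled
  coefficient, and a single coefficient is controlled by the sum of fourth powers.\<close>

lemma tame_level_bound:
  assumes "tame \<omega>"
  obtains b where "summable b" "\<And>n t. \<bar>level \<omega> n t\<bar> \<le> b n"
proof -
  define f where "f n = (\<Sum>k<2^n. \<omega> (2^n + k) ^ 4) / 3 ^ n" for n
  have f0: "f n \<ge> 0" for n unfolding f_def by (intro divide_nonneg_nonneg sum_nonneg) auto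
  have sf: "summable f"
    using assms f0 unfolding tame_def f_def[symmetric] by (intro summable_suminf_not_top) auto
  define C where "C = suminf f"
  have fC: "f n \<le> C" for n
    unfolding C_def using sum_le_suminf[OF sf, of "{n}"] f0 by auto
  then have C0: "C \<ge> 0" using f0 order_trans by blast
  \<comment> \<open>Fourth root of C * (3/4)^n: a fourth power is at most C * 3^n, and the Schauder
    normalisation to the fourth power is 16 * 4^n. The factor 16 is given away.\<close>
  define b where "b n = root 4 C * root 4 (3/4) ^ n" for n
  have "summable b"
    unfolding b_def by (intro summable_mult summable_geometric) (simp add: real_root_lt_1_iff)
  moreover have "\<bar>level \<omega> n t\<bar> \<le> b n" for n t
  proof -
    have om: "\<bar>\<omega> (2^n + k)\<bar> / sqrt (2 ^ (n + 2)) \<le> b n" if "k < 2^n" for k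
    proof -
      have "\<omega> (2^n + k) ^ 4 \<le> (\<Sum>k<2^n. \<omega> (2^n + k) ^ 4)"
        using that by (intro member_le_sum) auto
      also have "\<dots> = f n * 3 ^ n" by (simp add: f_def)
      also have "\<dots> \<le> C * 3 ^ n" by (intro mult_right_mono fC) auto
      finally have 1: "\<omega> (2^n + k) ^ 4 \<le> C * 3 ^ n" .
      have s4: "sqrt (2 ^ (n + 2)) ^ 4 = 4 ^ n * 16"
      proof -
        have "sqrt x ^ 4 = x ^ 2" if "x \<ge> 0" for x
          using that power_mult[of "sqrt x" 2 2] by simp
        then have "sqrt (2 ^ (n + 2)) ^ 4 = (2 ^ (n + 2)) ^ 2" by simp
        also have "\<dots> = 4 ^ n * 16" by (simp add: power_mult_distrib power2_eq_square flip: power_mult_distrib)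
        finally show ?thesis .
      qed
      have "(\<bar>\<omega> (2^n + k)\<bar> / sqrt (2 ^ (n + 2))) ^ 4 = \<omega> (2^n + k) ^ 4 / (4 ^ n * 16)"
        unfolding power_divide s4 by (simp add: power_even_abs)
      also have "\<dots> \<le> C * 3 ^ n / (4 ^ n * 16)" by (intro divide_right_mono 1) auto
      also have "\<dots> \<le> C * (3/4) ^ n" using C0 by (simp add: power_divide field_simps)
      also have "\<dots> = b n ^ 4"
      proof -
        have "(root 4 (3/4) ^ n) ^ 4 = (root 4 (3/4) ^ 4) ^ n" by (metis mult.commute power_mult)
        then show ?thesis using C0 by (simp add: b_def power_mult_distrib)
      qed
      finally have "(\<bar>\<omega> (2^n + k)\<bar> / sqrt (2 ^ (n + 2))) ^ Suc 3 \<le> b n ^ Suc 3" by simp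
      then show ?thesis by (rule power_le_imp_le_base) (simp add: b_def C0)
    qed
    have bn: "b n \<ge> 0" using C0 by (simp add: b_def)
    have "\<bar>level \<omega> n t\<bar> \<le> (\<Sum>k<2^n. \<bar>\<omega> (2^n + k) * schauder (2^n + k) t\<bar>)"
      unfolding level_def by (rule sum_abs)
    also have "\<dots> = (\<Sum>k<2^n. (\<bar>\<omega> (2^n + k)\<bar> / sqrt (2 ^ (n + 2))) * tent (2^n * t - real k))"
      by (intro sum.cong refl) (simp add: schauder_level abs_mult tent_nonneg del: power_add)
    also have "\<dots> \<le> (\<Sum>k<2^n. b n * tent (2^n * t - real k))"
      by (intro sum_mono mult_right_mono om tent_nonneg) auto
    also have "\<dots> = b n * (\<Sum>k<2^n. tent (2^n * t - real k))" by (simp add: sum_distrib_left)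
    also have "\<dots> \<le> b n * 1" by (intro mult_left_mono sum_tent_le_1 bn)
    finally show ?thesis by simp
  qed
  ultimately show ?thesis using that by blast
qed

definition levy_path :: "(nat \<Rightarrow> real) \<Rightarrow> real \<Rightarrow> real" where
  "levy_path \<omega> t = \<omega> 0 * t + (\<Sum>n. level \<omega> n t)"

lemma levy_path_limit:
  assumes "tame \<omega>"
  shows "(\<lambda>N. \<Sum>m<2^N. \<omega> m * schauder m t) \<longlonglongrightarrow> levy_path \<omega> t"
proof -
  obtain b where b: "summable b" "\<And>n t. \<bar>level \<omega> n t\<bar> \<le> b n" by (rule tame_level_bound[OF assms]) blast
  have "summable (\<lambda>n. level \<omega> n t)"
    by (rule summable_comparison_test'[OF b(1), of 0]) (use b(2) in auto)
  then have "(\<lambda>N. \<omega> 0 * t + (\<Sum>n<N. level \<omega> n t)) \<longlonglongrightarrow> levy_path \<omega> t"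
    unfolding levy_path_def by (intro tendsto_intros summable_LIMSEQ)
  then show ?thesis
    by (subst sum_lessThan_dyadic) (simp add: level_def schauder_0)
qed

lemma continuous_on_schauder: "continuous_on A (schauder m)"
  unfolding schauder_def tent_def by (cases "m = 0") (auto intro!: continuous_intros)

text \<open>The bounds on the levels do not depend on t, so the Weierstrass test applies on any set
  at once.\<close>

lemma levy_path_continuous:
  assumes "tame \<omega>"
  shows "continuous_on A (levy_path \<omega>)"
proof -
  obtain b where b: "summable b" "\<And>n t. \<bar>level \<omega> n t\<bar> \<le> b n" by (rule tame_level_bound[OF assms]) blast
  have "uniform_limit A (\<lambda>N t. \<Sum>n<N. level \<omega> n t) (\<lambda>t. \<Sum>n. level \<omega> n t) sequentially"
    by (rule Weierstrass_m_test[OF _ b(1)]) (use b(2) in auto)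
  then have "continuous_on A (\<lambda>t. \<Sum>n. level \<omega> n t)"
    by (rule uniform_limit_theorem[rotated])
      (auto simp: level_def intro!: always_eventually continuous_intros continuous_on_schauder)
  then show ?thesis unfolding levy_path_def by (intro continuous_intros)
qed

lemma levy_path_0: "levy_path \<omega> 0 = 0"
proof -
  have "level \<omega> n 0 = 0" for n
    unfolding level_def by (intro sum.neutral ballI) (auto simp: schauder_level tent_def)
  then show ?thesis by (simp add: levy_path_def)
qed

section \<open>Existence of Wiener measure\<close>

abbreviation gauss_seq :: "(nat \<Rightarrow> real) measure" where
  "gauss_seq \<equiv> \<Pi>\<^sub>M _\<in>UNIV. std_normal_distribution"

lemma prob_space_std_normal: "prob_space std_normal_distribution"
  using real_dist_normal_dist by (simp add: real_distribution_def)

lemma prob_space_gauss_seq: "prob_space gauss_seq"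
  by (intro prob_space_PiM prob_space_std_normal)

lemma measurable_gauss_seq_component[measurable]: "(\<lambda>\<omega>. \<omega> m) \<in> borel_measurable gauss_seq"
  using measurable_component_singleton[of m UNIV "\<lambda>_. std_normal_distribution"]
  by (simp cong: measurable_cong_sets)

lemma gauss_seq_component: "distr gauss_seq borel (\<lambda>\<omega>. \<omega> m) = std_normal_distribution"
  using distr_PiM_component[of UNIV "\<lambda>_. std_normal_distribution" m] prob_space_std_normal
  by (simp cong: distr_cong)

lemma gauss_seq_normal: "distributed gauss_seq lborel (\<lambda>\<omega>. \<omega> m) (normal_density 0 1)"
  using gauss_seq_component[of m] unfolding distributed_def by (simp cong: distr_cong)

lemma gauss_seq_indep: "prob_space.indep_vars gauss_seq (\<lambda>_. borel) (\<lambda>m \<omega>. \<omega> m) UNIV"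
proof -
  interpret prob_space gauss_seq by (rule prob_space_gauss_seq)
  have "sets (PiM UNIV (\<lambda>_::nat. borel :: real measure)) = sets gauss_seq"
    by (intro sets_PiM_cong) auto
  then have "distr gauss_seq (PiM UNIV (\<lambda>_. borel)) (\<lambda>\<omega>. \<lambda>i\<in>UNIV. \<omega> i) = gauss_seq"
    by (simp add: restrict_def distr_id2)
  then show ?thesis
    by (subst indep_vars_iff_distr_eq_PiM) (auto simp: gauss_seq_component)
qed

lemma char_gauss_seq:
  "(LINT \<omega>|gauss_seq. iexp (\<Sum>m<K. c m * \<omega> m)) = complex_of_real (exp (- (\<Sum>m<K. (c m)\<^sup>2) / 2))"
proof -
  interpret prob_space gauss_seq by (rule prob_space_gauss_seq)
  show ?thesis
    using char_indep_normal[of "{..<K}" "\<lambda>_. 1" "\<lambda>m \<omega>. \<omega> m" c]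
      indep_vars_subset[OF gauss_seq_indep] gauss_seq_normal by simp
qed

lemma measurable_tame[measurable]: "Measurable.pred gauss_seq tame"
  unfolding tame_def by measurable

text \<open>The fourth moment of a standard normal is 3, and level n has 2^n terms, so its summand
  has mean 3 * (2/3)^n. The whole series has finite mean and is therefore almost surely
  finite.\<close>

lemma AE_tame: "AE \<omega> in gauss_seq. tame \<omega>"
proof -
  interpret prob_space gauss_seq by (rule prob_space_gauss_seq)
  have m4: "(\<integral>\<^sup>+\<omega>. ennreal (\<omega> m ^ 4) \<partial>gauss_seq) = 3" for m
  proof -
    have "(\<integral>\<^sup>+\<omega>. ennreal (\<omega> m ^ 4) \<partial>gauss_seq) = (\<integral>\<^sup>+x. ennreal (x ^ 4) \<partial>distr gauss_seq borel (\<lambda>\<omega>. \<omega> m))"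
      by (subst nn_integral_distr) auto
    also have "\<dots> = ennreal (LINT x|std_normal_distribution. x ^ 4)"
      unfolding gauss_seq_component
      using std_normal_distribution_even_moments(2)[of 2] by (intro nn_integral_eq_integral) auto
    also have "\<dots> = 3"
      using std_normal_distribution_even_moments(1)[of 2] by (simp add: fact_numeral)
    finally show ?thesis .
  qed
  have "(\<integral>\<^sup>+\<omega>. (\<Sum>n. ennreal ((\<Sum>k<2^n. \<omega> (2^n + k) ^ 4) / 3 ^ n)) \<partial>gauss_seq)
      = (\<Sum>n. \<integral>\<^sup>+\<omega>. ennreal ((\<Sum>k<2^n. \<omega> (2^n + k) ^ 4) / 3 ^ n) \<partial>gauss_seq)"
    by (rule nn_integral_suminf) measurable
  also have "\<dots> = (\<Sum>n. ennreal (3 * (2/3) ^ n))"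
  proof (intro suminf_cong)
    fix n
    have "ennreal ((\<Sum>k<2^n. \<omega> (2^n + k) ^ 4) / 3 ^ n) = ennreal (1 / 3 ^ n) * (\<Sum>k<2^n. ennreal (\<omega> (2^n + k) ^ 4))" for \<omega> :: "nat \<Rightarrow> real"
      by (subst sum_ennreal) (auto simp: ennreal_mult'[symmetric])
    then have "(\<integral>\<^sup>+\<omega>. ennreal ((\<Sum>k<2^n. \<omega> (2^n + k) ^ 4) / 3 ^ n) \<partial>gauss_seq)
      = ennreal (1 / 3 ^ n) * (\<Sum>k<2^n. \<integral>\<^sup>+\<omega>. ennreal (\<omega> (2^n + k) ^ 4) \<partial>gauss_seq)"
      by (simp only:, subst nn_integral_cmult, measurable, subst nn_integral_sum) auto
    also have "\<dots> = ennreal (1 / 3 ^ n) * ennreal (2 ^ n * 3)"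
      unfolding m4 using ennreal_power[of 2 n] by (simp add: ennreal_mult)
    also have "\<dots> = ennreal (3 * (2/3) ^ n)"
      by (subst ennreal_mult[symmetric]) (auto simp: power_divide)
    finally show "(\<integral>\<^sup>+\<omega>. ennreal ((\<Sum>k<2^n. \<omega> (2^n + k) ^ 4) / 3 ^ n) \<partial>gauss_seq) = ennreal (3 * (2/3) ^ n)" .
  qed
  also have "\<dots> \<noteq> \<infinity>"
  proof -
    have "summable (\<lambda>n. 3 * (2/3 :: real) ^ n)" by (intro summable_mult summable_geometric) auto
    then have "(\<Sum>n. ennreal (3 * (2/3) ^ n)) = ennreal (\<Sum>n. 3 * (2/3) ^ n)"
      by (intro suminf_ennreal2) auto
    then show ?thesis by simp
  qed
  finally show ?thesis
    unfolding tame_def by (intro nn_integral_noteq_infinite) auto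
qed

text \<open>Brownian scaling carries the unit interval to \<open>{0..T}\<close>. Sequences that are
  not tame get the zero path, so that the map lands in \<open>C0 T\<close> everywhere and not just
  almost everywhere.\<close>

definition wpath :: "real \<Rightarrow> (nat \<Rightarrow> real) \<Rightarrow> real \<Rightarrow> real" where
  "wpath T \<omega> t = (if tame \<omega> \<and> t \<in> {0..T} then sqrt T * levy_path \<omega> (t / T) else 0)"

lemma wpath_C0: assumes "T > 0" shows "wpath T \<omega> \<in> C0 T"
proof (cases "tame \<omega>")
  case True
  have "continuous_on {0..T} (\<lambda>t. sqrt T * levy_path \<omega> (t / T))"
    using assms by (intro continuous_intros continuous_on_compose2[OF levy_path_continuous[OF True, of UNIV]]) auto
  then have "continuous_on {0..T} (wpath T \<omega>)"
    by (rule continuous_on_cong[THEN iffD1, rotated 2]) (auto simp: wpath_def True)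
  then show ?thesis by (auto simp: C0_def wpath_def levy_path_0)
next
  case False
  then have "wpath T \<omega> = (\<lambda>_. 0)" by (auto simp: wpath_def)
  then show ?thesis by (auto simp: C0_def)
qed

lemma measurable_wpath: "(\<lambda>\<omega>. wpath T \<omega> t) \<in> borel_measurable gauss_seq"
  unfolding wpath_def levy_path_def level_def by measurable

text \<open>Only a carrier of the sigma-algebra, as target of \<open>wpath\<close>.
  \<open>wiener T\<close> could not play this part before existence is settled, since its sets are
  unknown until then.\<close>

definition wiener_alg :: "real \<Rightarrow> (real \<Rightarrow> real) measure" where
  "wiener_alg T = sigma (C0 T) {{x \<in> C0 T. x t \<in> A} | t A. t \<in> {0..T} \<and> A \<in> sets borel}"

lemma sets_wiener_alg: "sets (wiener_alg T) = wiener_sets T" and space_wiener_alg: "space (wiener_alg T) = C0 T"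
proof -
  have "{{x \<in> C0 T. x t \<in> A} | t A. t \<in> {0..T} \<and> A \<in> sets borel} \<subseteq> Pow (C0 T)" by auto
  then show "sets (wiener_alg T) = wiener_sets T" "space (wiener_alg T) = C0 T"
    by (auto simp: wiener_sets_def wiener_alg_def)
qed

lemma measurable_eval_wiener:
  assumes "sets M = wiener_sets T" "space M = C0 T"
  shows "(\<lambda>x. x t) \<in> borel_measurable M"
proof (cases "t \<in> {0..T}")
  case True
  show ?thesis
  proof (rule measurableI)
    fix A :: "real set" assume "A \<in> sets borel"
    then show "(\<lambda>x. x t) -` A \<inter> space M \<in> sets M"
      using True unfolding assms wiener_sets_def
      by (intro sigma_sets.Basic) (auto intro!: exI[of _ t] exI[of _ A])
  qed simp
next
  case False
  then show ?thesis
    by (subst measurable_cong[where g="\<lambda>_. 0"]) (auto simp: assms C0_def)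
qed

lemmas measurable_eval_wiener_alg[measurable] = measurable_eval_wiener[OF sets_wiener_alg space_wiener_alg]

lemma wiener_exists:
  assumes T: "T > 0"
  shows "\<exists>M. prob_space M \<and> space M = C0 T \<and> sets M = wiener_sets T \<and> bm_property T M"
proof -
  interpret G: prob_space gauss_seq by (rule prob_space_gauss_seq)
  have meas: "wpath T \<in> measurable gauss_seq (wiener_alg T)"
    unfolding wiener_alg_def
  proof (rule measurable_measure_of)
    fix y assume "y \<in> {{x \<in> C0 T. x t \<in> A} | t A. t \<in> {0..T} \<and> A \<in> sets borel}"
    then obtain t A where A: "A \<in> sets borel" and y: "y = {x \<in> C0 T. x t \<in> A}" by auto
    have "wpath T -` y \<inter> space gauss_seq = (\<lambda>\<omega>. wpath T \<omega> t) -` A \<inter> space gauss_seq"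
      using wpath_C0[OF T] by (auto simp: y)
    then show "wpath T -` y \<inter> space gauss_seq \<in> sets gauss_seq"
      using measurable_sets[OF measurable_wpath A] by simp
  qed (use wpath_C0[OF T] in auto)
  define W where "W = distr gauss_seq (wiener_alg T) (wpath T)"
  have W: "sets W = wiener_sets T" "space W = C0 T"
    unfolding W_def sets_distr space_distr by (rule sets_wiener_alg space_wiener_alg)+
  interpret W: prob_space W unfolding W_def by (rule G.prob_space_distr[OF meas])
  have [measurable]: "(\<lambda>x. x t) \<in> borel_measurable W" for t
    by (rule measurable_eval_wiener[OF W])
  have bm: "W.indep_vars (\<lambda>_. borel) (\<lambda>i x. x (ts (Suc i)) - x (ts i)) {..<k} \<and>
          (\<forall>i<k. distributed W lborel (\<lambda>x. x (ts (Suc i)) - x (ts i))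
                   (\<lambda>r. ennreal (normal_density 0 (sqrt (ts (Suc i) - ts i)) r)))"
    if ts: "ts 0 = 0" "\<forall>i<k. ts i < ts (Suc i)" "ts k \<le> T" for k and ts :: "nat \<Rightarrow> real"
  proof -
    have mono: "ts i \<le> ts j" if "i \<le> j" "j \<le> k" for i j
      using that
    proof (induction j rule: dec_induct)
      case (step j)
      then have "ts i \<le> ts j" "ts j < ts (Suc j)" using ts(2) by auto
      then show ?case by simp
    qed simp
    have rng: "ts i \<in> {0..T}" if "i \<le> k" for i
      using mono[of 0 i] mono[of i k] that ts by auto
    define a where "a i = ts i / T" for i
    have a: "a i \<in> {0..1}" if "i \<le> k" for i using rng[OF that] T by (auto simp: a_def)
    define D where "D i m = schauder m (a (Suc i)) - schauder m (a i)" for i m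
    \<comment> \<open>Four applications of \<open>schauder_cov\<close> combine to the length of the
      overlap of the i-th and the j-th interval; for distinct indices the intervals meet at most in
      an endpoint.\<close>
    have covD: "(\<lambda>N. \<Sum>m<2^N. D i m * D j m) \<longlonglongrightarrow> (if i = j then a (Suc i) - a i else 0)" if ij: "i < k" "j < k" for i j
    proof -
      have "(\<Sum>m<2^N. D i m * D j m) = (\<Sum>m<2^N. schauder m (a (Suc i)) * schauder m (a (Suc j)))
        - (\<Sum>m<2^N. schauder m (a (Suc i)) * schauder m (a j))
        - (\<Sum>m<2^N. schauder m (a i) * schauder m (a (Suc j)))
        + (\<Sum>m<2^N. schauder m (a i) * schauder m (a j))" for N
        by (simp add: D_def algebra_simps sum.distrib sum_subtractf)
      then have "(\<lambda>N. \<Sum>m<2^N. D i m * D j m) \<longlonglongrightarrow> min (a (Suc i)) (a (Suc j)) - min (a (Suc i)) (a j)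
          - min (a i) (a (Suc j)) + min (a i) (a j)"
        using ij by (simp only:) (intro tendsto_intros schauder_cov a; simp)
      moreover have "min (a (Suc i)) (a (Suc j)) - min (a (Suc i)) (a j) - min (a i) (a (Suc j)) + min (a i) (a j)
          = (if i = j then a (Suc i) - a i else 0)"
      proof -
        have am: "a i \<le> a j" if "i \<le> j" "j \<le> k" for i j
          using mono[OF that] T by (simp add: a_def divide_right_mono)
        consider "i = j" | "i < j" | "j < i" by linarith
        then show ?thesis
        proof cases
          case 1
          then show ?thesis using am[of i "Suc i"] ij by (auto simp: min_def)
        next
          case 2
          then show ?thesis using am[of i "Suc i"] am[of "Suc i" j] am[of j "Suc j"] ij by (auto simp: min_def)
        next
          case 3
          then show ?thesis using am[of i "Suc i"] am[of "Suc j" i] am[of j "Suc j"] ij by (auto simp: min_def)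
        qed
      qed
      ultimately show ?thesis by simp
    qed
    have ch: "(LINT x|W. iexp (\<Sum>i<k. u i * (x (ts (Suc i)) - x (ts i))))
        = complex_of_real (exp (- (\<Sum>i<k. (u i * sqrt (ts (Suc i) - ts i))\<^sup>2) / 2))" for u
    proof -
      \<comment> \<open>The coefficient of \<open>\<omega> m\<close> in the combination of
        increments, after swapping the two sums. The truncations m < 2^N below follow complete
        levels, along which the path series is known to converge.\<close>
      define c where "c m = (\<Sum>i<k. u i * sqrt T * D i m)" for m
      have "(LINT x|W. iexp (\<Sum>i<k. u i * (x (ts (Suc i)) - x (ts i))))
          = (LINT \<omega>|gauss_seq. iexp (\<Sum>i<k. u i * (wpath T \<omega> (ts (Suc i)) - wpath T \<omega> (ts i))))"
        unfolding W_def using meas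
        by (subst integral_distr) auto
      also have "\<dots> = complex_of_real (exp (- (\<Sum>i<k. (u i * sqrt (ts (Suc i) - ts i))\<^sup>2) / 2))"
      proof (rule G.char_limit[where Y="\<lambda>N \<omega>. \<Sum>m<2^N. c m * \<omega> m" and v="\<lambda>N. \<Sum>m<2^N. (c m)\<^sup>2"])
        show "(\<lambda>\<omega>. \<Sum>i<k. u i * (wpath T \<omega> (ts (Suc i)) - wpath T \<omega> (ts i))) \<in> borel_measurable gauss_seq"
          by (intro borel_measurable_sum borel_measurable_times borel_measurable_diff measurable_wpath) auto
        show "AE \<omega> in gauss_seq. (\<lambda>N. \<Sum>m<2^N. c m * \<omega> m)
            \<longlonglongrightarrow> (\<Sum>i<k. u i * (wpath T \<omega> (ts (Suc i)) - wpath T \<omega> (ts i)))"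
          using AE_tame
        proof eventually_elim
          case (elim \<omega>)
          have "(\<lambda>N. \<Sum>i<k. u i * (sqrt T * (\<Sum>m<2^N. \<omega> m * schauder m (a (Suc i))) - sqrt T * (\<Sum>m<2^N. \<omega> m * schauder m (a i))))
             \<longlonglongrightarrow> (\<Sum>i<k. u i * (sqrt T * levy_path \<omega> (a (Suc i)) - sqrt T * levy_path \<omega> (a i)))"
            by (intro tendsto_intros levy_path_limit elim)
          moreover have "(\<Sum>i<k. u i * (sqrt T * (\<Sum>m<2^N. \<omega> m * schauder m (a (Suc i))) - sqrt T * (\<Sum>m<2^N. \<omega> m * schauder m (a i))))
             = (\<Sum>m<2^N. c m * \<omega> m)" for N
          proof -
            have "(\<Sum>m<2^N. c m * \<omega> m) = (\<Sum>i<k. \<Sum>m<2^N. u i * sqrt T * D i m * \<omega> m)"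
              unfolding c_def sum_distrib_right by (rule sum.swap)
            also have "\<dots> = (\<Sum>i<k. u i * (sqrt T * (\<Sum>m<2^N. \<omega> m * schauder m (a (Suc i))) - sqrt T * (\<Sum>m<2^N. \<omega> m * schauder m (a i))))"
              by (simp add: D_def sum_distrib_left right_diff_distrib left_diff_distrib sum_subtractf mult_ac)
            finally show ?thesis ..
          qed
          moreover have "wpath T \<omega> (ts i) = sqrt T * levy_path \<omega> (a i)" if "i \<le> k" for i
            using rng[OF that] elim by (simp add: wpath_def a_def)
          then have "(\<Sum>i<k. u i * (wpath T \<omega> (ts (Suc i)) - wpath T \<omega> (ts i)))
            = (\<Sum>i<k. u i * (sqrt T * levy_path \<omega> (a (Suc i)) - sqrt T * levy_path \<omega> (a i)))"
            by (intro sum.cong refl) (simp add: less_imp_le_nat)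
          ultimately show ?case by simp
        qed
        show "(\<lambda>N. \<Sum>m<2^N. (c m)\<^sup>2) \<longlonglongrightarrow> (\<Sum>i<k. (u i * sqrt (ts (Suc i) - ts i))\<^sup>2)"
        proof -
          have "(\<Sum>m<2^N. (c m)\<^sup>2) = (\<Sum>i<k. \<Sum>j<k. u i * u j * T * (\<Sum>m<2^N. D i m * D j m))" for N
          proof -
            have "(\<Sum>m<2^N. (c m)\<^sup>2) = (\<Sum>m<2^N. \<Sum>i<k. \<Sum>j<k. u i * u j * T * (D i m * D j m))"
              unfolding c_def power2_eq_square sum_product using T
              by (intro sum.cong refl) (simp add: mult_ac)
            also have "\<dots> = (\<Sum>i<k. \<Sum>j<k. \<Sum>m<2^N. u i * u j * T * (D i m * D j m))"
              by (rule trans[OF sum.swap], rule sum.cong[OF refl], rule sum.swap)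
            finally show ?thesis by (simp add: sum_distrib_left)
          qed
          moreover have "(\<lambda>N. \<Sum>i<k. \<Sum>j<k. u i * u j * T * (\<Sum>m<2^N. D i m * D j m))
             \<longlonglongrightarrow> (\<Sum>i<k. \<Sum>j<k. u i * u j * T * (if i = j then a (Suc i) - a i else 0))"
            by (intro tendsto_sum tendsto_mult tendsto_const covD) auto
          moreover have "(\<Sum>i<k. \<Sum>j<k. u i * u j * T * (if i = j then a (Suc i) - a i else 0)) = (\<Sum>i<k. (u i * sqrt (ts (Suc i) - ts i))\<^sup>2)"
          proof (intro sum.cong refl)
            fix i assume i: "i \<in> {..<k}"
            have "(\<Sum>j<k. u i * u j * T * (if i = j then a (Suc i) - a i else 0)) = (\<Sum>j<k. if j = i then u i * u i * T * (a (Suc i) - a i) else 0)"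
              by (intro sum.cong refl) auto
            also have "\<dots> = u i * u i * T * (a (Suc i) - a i)" using i by simp
            also have "\<dots> = (u i)\<^sup>2 * (ts (Suc i) - ts i)"
              using T by (simp add: a_def power2_eq_square right_diff_distrib)
            also have "\<dots> = (u i * sqrt (ts (Suc i) - ts i))\<^sup>2"
              using ts(2) i by (simp add: power_mult_distrib less_imp_le)
            finally show "(\<Sum>j<k. u i * u j * T * (if i = j then a (Suc i) - a i else 0)) = (u i * sqrt (ts (Suc i) - ts i))\<^sup>2" .
          qed
          ultimately show ?thesis by simp
        qed
      qed (auto simp: char_gauss_seq[simplified])
      finally show ?thesis .
    qed
    have "sqrt (ts (Suc i) - ts i) > 0" if "i < k" for i using ts(2) that by simp
    with ch show ?thesis
      using W.indep_normal_if_char[of k "\<lambda>i x. x (ts (Suc i)) - x (ts i)" "\<lambda>i. sqrt (ts (Suc i) - ts i)"] by auto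
  qed
  then have "bm_property T W" unfolding bm_property_def by blast
  then show ?thesis using W W.prob_space_axioms by blast
qed

lemma wiener:
  assumes "T > 0"
  shows "prob_space (wiener T)" "space (wiener T) = C0 T" "sets (wiener T) = wiener_sets T" "bm_property T (wiener T)"
  using someI_ex[OF wiener_exists[OF assms]] unfolding wiener_def by auto

section \<open>Stochastic integrals of the cosine basis\<close>

text \<open>With \<open>Suc n\<close> cells there is no division by zero, and for positive T the
  points form an admissible time sequence for \<open>bm_property\<close>: they start at 0, increase
  strictly and end at T.\<close>

definition grid :: "real \<Rightarrow> nat \<Rightarrow> nat \<Rightarrow> real" where
  "grid T n i = T * real i / real (Suc n)"

lemma grid_0[simp]: "grid T n 0 = 0" and grid_last[simp]: "grid T n (Suc n) = T"
  by (simp_all add: grid_def)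

lemma grid_step: "grid T n (Suc i) - grid T n i = T / real (Suc n)"
  by (simp add: grid_def flip: diff_divide_distrib) (simp add: algebra_simps)

lemma grid_less: "T > 0 \<Longrightarrow> grid T n i < grid T n (Suc i)"
  by (simp add: grid_def divide_strict_right_mono)

lemma grid_mem: "T > 0 \<Longrightarrow> i \<le> Suc n \<Longrightarrow> grid T n i \<in> {0..T}"
  using mult_left_mono[of "real i" "1 + real n" T] by (simp add: grid_def field_simps)

lemma integral_grid:
  fixes f :: "real \<Rightarrow> real"
  assumes T: "T > 0" and f: "f integrable_on {0..T}" and m: "m \<le> Suc n"
  shows "integral {0..grid T n m} f = (\<Sum>i<m. integral {grid T n i..grid T n (Suc i)} f)"
  using m
proof (induction m)
  case (Suc m)
  have "f integrable_on {0..grid T n (Suc m)}"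
    by (rule integrable_subinterval_real[OF f]) (use grid_mem[OF T Suc.prems] in auto)
  then have "integral {0..grid T n m} f + integral {grid T n m..grid T n (Suc m)} f = integral {0..grid T n (Suc m)} f"
    using grid_mem[OF T, of m n] grid_less[OF T, of n m] Suc.prems
    by (intro Henstock_Kurzweil_Integration.integral_combine) auto
  then show ?case using Suc by simp
qed simp

text \<open>The weight h is integrated exactly on each cell and only x is sampled, so uniform
  continuity of x and a bound on h suffice. With h the derivative of a basis function the cell
  integrals are its increments; with h = 1 ordinary Riemann sums result.\<close>

lemma riemann_stieltjes_limit:
  fixes x h :: "real \<Rightarrow> real"
  assumes T: "T > 0" and x: "continuous_on {0..T} x" and h: "continuous_on {0..T} h"
    and tag: "\<And>n i. i < Suc n \<Longrightarrow> \<tau> n i \<in> {grid T n i..grid T n (Suc i)}"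
  shows "(\<lambda>n. \<Sum>i<Suc n. x (\<tau> n i) * integral {grid T n i..grid T n (Suc i)} h)
     \<longlonglongrightarrow> integral {0..T} (\<lambda>t. x t * h t)"
proof -
  obtain B where B: "\<And>t. t \<in> {0..T} \<Longrightarrow> \<bar>h t\<bar> \<le> B" and B0: "B > 0"
    using compact_imp_bounded[OF compact_continuous_image[OF h]]
    by (force simp: bounded_pos)
  have xh: "continuous_on {0..T} (\<lambda>t. x t * h t)" by (intro continuous_intros x h)
  have uc: "uniformly_continuous_on {0..T} x"
    by (rule compact_uniformly_continuous[OF x]) auto
  show ?thesis
  proof (rule LIMSEQ_I)
    fix r :: real assume "r > 0"
    \<comment> \<open>Chosen so that the cell errors e * B * (T / (n + 1)) add up to r / 2.\<close>
    define e where "e = r / (2 * B * T)"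
    have e: "e > 0" using \<open>r > 0\<close> B0 T by (simp add: e_def)
    obtain d where d: "d > 0" "\<And>s t. s \<in> {0..T} \<Longrightarrow> t \<in> {0..T} \<Longrightarrow> \<bar>s - t\<bar> < d \<Longrightarrow> \<bar>x s - x t\<bar> < e"
      using uc e unfolding uniformly_continuous_on_def dist_real_def by (metis abs_minus_commute)
    obtain N where N: "T / real (Suc N) < d"
      using reals_Archimedean[of "d / T"] d T by (auto simp: field_simps)
    show "\<exists>no. \<forall>n\<ge>no. norm ((\<Sum>i<Suc n. x (\<tau> n i) * integral {grid T n i..grid T n (Suc i)} h) - integral {0..T} (\<lambda>t. x t * h t)) < r"
    proof (intro exI allI impI)
      fix n assume n: "n \<ge> N"
      have "T / real (Suc n) \<le> T / real (Suc N)" using n T by (intro divide_left_mono) auto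
      then have nd: "T / real (Suc n) < d" using N by simp
      let ?I = "\<lambda>i. {grid T n i..grid T n (Suc i)}"
      have sub: "?I i \<subseteq> {0..T}" if "i < Suc n" for i
        using grid_mem[OF T, of i n] grid_mem[OF T, of "Suc i" n] that by auto
      have hI: "h integrable_on ?I i" and xhI: "(\<lambda>t. x t * h t) integrable_on ?I i" if "i < Suc n" for i
        using continuous_on_subset[OF h sub[OF that]] continuous_on_subset[OF xh sub[OF that]]
        by (auto intro: integrable_continuous_real)
      have "(\<Sum>i<Suc n. x (\<tau> n i) * integral (?I i) h) - integral {0..T} (\<lambda>t. x t * h t)
        = (\<Sum>i<Suc n. x (\<tau> n i) * integral (?I i) h - integral (?I i) (\<lambda>t. x t * h t))"
        using integral_grid[OF T integrable_continuous_real[OF xh], of "Suc n" n] unfolding sum_subtractf by simp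
      also have "norm \<dots> \<le> (\<Sum>i<Suc n. e * B * (T / real (Suc n)))"
      proof (rule sum_norm_le)
        fix i assume "i \<in> {..<Suc n}"
        then have i: "i < Suc n" by simp
        have "x (\<tau> n i) * integral (?I i) h - integral (?I i) (\<lambda>t. x t * h t) = integral (?I i) (\<lambda>t. x (\<tau> n i) * h t - x t * h t)"
          using hI[OF i] xhI[OF i] by (subst Henstock_Kurzweil_Integration.integral_diff) (auto intro: integrable_on_mult_right)
        also have "norm \<dots> \<le> (e * B) * (grid T n (Suc i) - grid T n i)"
        proof (rule integral_bound)
          show "grid T n i \<le> grid T n (Suc i)" using grid_less[OF T] less_imp_le by blast
          have "continuous_on (?I i) h" "continuous_on (?I i) x"
            using continuous_on_subset[OF h sub[OF i]] continuous_on_subset[OF x sub[OF i]] by auto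
          then show "continuous_on (?I i) (\<lambda>t. x (\<tau> n i) * h t - x t * h t)"
            by (intro continuous_intros)
          fix t assume t: "t \<in> ?I i"
          have "\<bar>\<tau> n i - t\<bar> \<le> grid T n (Suc i) - grid T n i" using tag[OF i] t by auto
          then have "\<bar>\<tau> n i - t\<bar> < d" using nd unfolding grid_step by simp
          moreover have "\<tau> n i \<in> {0..T}" "t \<in> {0..T}" using sub[OF i] t tag[OF i] by blast+
          ultimately have 1: "\<bar>x (\<tau> n i) - x t\<bar> < e" "\<bar>h t\<bar> \<le> B" using d(2) B by auto
          have "norm (x (\<tau> n i) * h t - x t * h t) = \<bar>x (\<tau> n i) - x t\<bar> * \<bar>h t\<bar>"
            by (simp add: abs_mult flip: left_diff_distrib)
          also have "\<dots> \<le> e * B" using 1 e B0 by (intro mult_mono) auto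
          finally show "norm (x (\<tau> n i) * h t - x t * h t) \<le> e * B" .
        qed
        finally show "norm (x (\<tau> n i) * integral (?I i) h - integral (?I i) (\<lambda>t. x t * h t)) \<le> e * B * (T / real (Suc n))"
          unfolding grid_step .
      qed
      also have "\<dots> = e * B * T" by simp
      also have "\<dots> < r" using \<open>r > 0\<close> B0 T by (simp add: e_def)
      finally show "norm ((\<Sum>i<Suc n. x (\<tau> n i) * integral (?I i) h) - integral {0..T} (\<lambda>t. x t * h t)) < r" .
    qed
  qed
qed

lemma riemann_sum_limit:
  fixes x :: "real \<Rightarrow> real"
  assumes T: "T > 0" and x: "continuous_on {0..T} x"
  shows "(\<lambda>n. \<Sum>i<Suc n. x (grid T n (Suc i)) * (grid T n (Suc i) - grid T n i)) \<longlonglongrightarrow> integral {0..T} x"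
proof -
  have le: "grid T n i \<le> grid T n (Suc i)" for n i using grid_less[OF T] less_imp_le by blast
  have "(\<lambda>n. \<Sum>i<Suc n. x (grid T n (Suc i)) * integral {grid T n i..grid T n (Suc i)} (\<lambda>_. 1))
     \<longlonglongrightarrow> integral {0..T} (\<lambda>t. x t * 1)"
    by (rule riemann_stieltjes_limit[OF T x]) (auto simp: le)
  then show ?thesis by (simp add: le)
qed

lemma cosb_deriv: "T > 0 \<Longrightarrow> (cosb T j has_real_derivative cosb' T j t) (at t within A)"
  unfolding cosb_def cosb'_def
  by (cases "j = 0") (auto intro!: derivative_eq_intros)

lemma continuous_cosb: "continuous_on A (cosb T j)" and continuous_cosb': "continuous_on A (cosb' T j)"
  unfolding cosb_def cosb'_def by (cases "j = 0"; auto intro!: continuous_intros simp: divide_inverse)+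

lemma rs_int_eq:
  assumes "T > 0" and x: "continuous_on {0..T} x"
  shows "rs_int T j x = cosb T j T * x T - integral {0..T} (\<lambda>t. x t * cosb' T j t)"
proof -
  have "continuous_on {0..T} (\<lambda>t. x t * cosb' T j t)"
    by (intro continuous_intros x continuous_cosb')
  then have "set_integrable lborel {0..T} (\<lambda>t. x t * cosb' T j t)"
    by (intro borel_integrable_atLeastAtMost') auto
  then show ?thesis unfolding rs_int_def by (simp add: set_borel_integral_eq_integral(2))
qed

lemma sum_by_parts:
  fixes f g :: "nat \<Rightarrow> 'a::comm_ring"
  shows "(\<Sum>i<n. f (Suc i) * (g (Suc i) - g i)) = f n * g n - f 0 * g 0 - (\<Sum>i<n. g i * (f (Suc i) - f i))"
  by (induction n) (auto simp: algebra_simps)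

text \<open>\<open>rs_int\<close> is written by parts and contains no increments of x. Summation by
  parts restores them, which is the form on which the Brownian property acts; right endpoints for
  the basis function correspond to left endpoints for x.\<close>

lemma rs_int_limit:
  assumes T: "T > 0" and x: "x \<in> C0 T"
  shows "(\<lambda>n. \<Sum>i<Suc n. cosb T j (grid T n (Suc i)) * (x (grid T n (Suc i)) - x (grid T n i))) \<longlonglongrightarrow> rs_int T j x"
proof -
  have xc: "continuous_on {0..T} x" and x0: "x 0 = 0" using x by (auto simp: C0_def)
  have le: "grid T n i \<le> grid T n (Suc i)" for n i using grid_less[OF T] less_imp_le by blast
  have "integral {grid T n i..grid T n (Suc i)} (cosb' T j) = cosb T j (grid T n (Suc i)) - cosb T j (grid T n i)" for n i
    by (rule integral_unique, rule fundamental_theorem_of_calculus[OF le])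
      (use cosb_deriv[OF T] has_real_derivative_iff_has_vector_derivative in blast)
  then have "(\<lambda>n. \<Sum>i<Suc n. x (grid T n i) * (cosb T j (grid T n (Suc i)) - cosb T j (grid T n i)))
     \<longlonglongrightarrow> integral {0..T} (\<lambda>t. x t * cosb' T j t)"
    using riemann_stieltjes_limit[OF T xc continuous_cosb'[of _ T j], where \<tau>="\<lambda>n i. grid T n i"] le by (simp del: sum.lessThan_Suc)
  then have "(\<lambda>n. cosb T j T * x T - (\<Sum>i<Suc n. x (grid T n i) * (cosb T j (grid T n (Suc i)) - cosb T j (grid T n i))))
     \<longlonglongrightarrow> rs_int T j x"
    unfolding rs_int_eq[OF T xc] by (intro tendsto_intros)
  moreover have "(\<Sum>i<Suc n. cosb T j (grid T n (Suc i)) * (x (grid T n (Suc i)) - x (grid T n i)))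
     = cosb T j T * x T - (\<Sum>i<Suc n. x (grid T n i) * (cosb T j (grid T n (Suc i)) - cosb T j (grid T n i)))" for n
    using sum_by_parts[of "\<lambda>i. cosb T j (grid T n i)" "\<lambda>i. x (grid T n i)" "Suc n"] by (simp del: sum.lessThan_Suc add: x0)
  ultimately show ?thesis by simp
qed

lemma cos_int_zero:
  assumes T: "T > 0" and m: "m \<noteq> 0"
  shows "((\<lambda>t. cos (real_of_int m * pi * t / T)) has_integral 0) {0..T}"
proof -
  let ?c = "real_of_int m * pi / T"
  have c: "?c \<noteq> 0" using T m by simp
  have "((\<lambda>t. cos (real_of_int m * pi * t / T)) has_integral (sin (?c * T) / ?c - sin (?c * 0) / ?c)) {0..T}"
  proof (rule fundamental_theorem_of_calculus)
    fix t assume "t \<in> {0..T}"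
    show "((\<lambda>t. sin (?c * t) / ?c) has_vector_derivative cos (real_of_int m * pi * t / T)) (at t within {0..T})"
      unfolding has_real_derivative_iff_has_vector_derivative[symmetric]
      using c by (auto intro!: derivative_eq_intros simp: field_simps)
  qed (use T in simp)
  moreover have "sin (?c * T) = 0" using T by (simp add: sin_int_times_real[simplified] sin_zero_iff_int2)
  ultimately show ?thesis by simp
qed

lemma cosb_orthonormal:
  assumes T: "T > 0"
  shows "((\<lambda>t. cosb T i t * cosb T j t) has_integral (if i = j then 1 else 0)) {0..T}"
proof -
  have one: "((\<lambda>t. c) has_integral c * T) {0..T}" for c :: real
    using has_integral_const_real[of c 0 T] T by (simp add: mult.commute)
  have co: "((\<lambda>t. c * cos (real k * pi * t / T)) has_integral 0) {0..T}" if "k \<noteq> 0" for k c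
    using has_integral_mult_right[OF cos_int_zero[OF T, of "int k"], of c] that by simp
  have sT: "sqrt T * sqrt T = T" using T by simp
  have s2: "sqrt (2 / T) * sqrt (2 / T) = 2 / T" using T by (intro real_sqrt_mult_self[THEN trans]) simp
  consider "i = 0 \<and> j = 0" | "i = 0 \<and> j \<noteq> 0" | "i \<noteq> 0 \<and> j = 0" | "i \<noteq> 0 \<and> j \<noteq> 0" by blast
  then show ?thesis
  proof cases
    case 1
    then show ?thesis using one[of "1 / T"] T by (simp add: cosb_def)
  next
    case 2
    then show ?thesis using co[of j "1 / sqrt T * sqrt (2 / T)"] by (simp add: cosb_def mult.assoc)
  next
    case 3
    then show ?thesis using co[of i "1 / sqrt T * sqrt (2 / T)"] by (simp add: cosb_def mult_ac)
  next
    case 4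
    \<comment> \<open>Product-to-sum with integer frequencies, as i - j may be negative. Here i + j
      is never zero, while i - j is zero exactly on the diagonal and yields the 1 there.\<close>
    have eq: "cosb T i t * cosb T j t = 1 / T * cos (real_of_int (int i - int j) * pi * t / T) + 1 / T * cos (real_of_int (int i + int j) * pi * t / T)" for t
    proof -
      have "cosb T i t * cosb T j t = (sqrt (2 / T) * sqrt (2 / T)) * (cos (real i * pi * t / T) * cos (real j * pi * t / T))"
        using 4 by (simp add: cosb_def mult_ac del: real_sqrt_mult_self)
      also have "\<dots> = 1 / T * cos (real i * pi * t / T - real j * pi * t / T) + 1 / T * cos (real i * pi * t / T + real j * pi * t / T)"
        unfolding s2 cos_times_cos by (simp add: add_divide_distrib)
      finally show ?thesis by (simp add: algebra_simps add_divide_distrib diff_divide_distrib)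
    qed
    have p: "((\<lambda>t. 1 / T * cos (real_of_int (int i + int j) * pi * t / T)) has_integral 1 / T * 0) {0..T}"
      by (intro has_integral_mult_right cos_int_zero T) (use 4 in auto)
    have m: "((\<lambda>t. 1 / T * cos (real_of_int (int i - int j) * pi * t / T)) has_integral (if i = j then 1 else 0)) {0..T}"
    proof (cases "i = j")
      case True
      then show ?thesis using one[of "1 / T"] T by simp
    next
      case False
      then show ?thesis using has_integral_mult_right[OF cos_int_zero[OF T, of "int i - int j"], of "1 / T"] by simp
    qed
    show ?thesis unfolding eq using has_integral_add[OF m p] by simp
  qed
qed

lemma measurable_rs_int:
  assumes T: "T > 0"
  shows "rs_int T j \<in> borel_measurable (wiener T)"
proof (rule borel_measurable_LIMSEQ_real)
  show "(\<lambda>n. \<Sum>i<Suc n. cosb T j (grid T n (Suc i)) * (x (grid T n (Suc i)) - x (grid T n i))) \<longlonglongrightarrow> rs_int T j x"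
    if "x \<in> space (wiener T)" for x
    using rs_int_limit[OF T] that wiener(2)[OF T] by simp
  show "(\<lambda>x. \<Sum>i<Suc n. cosb T j (grid T n (Suc i)) * (x (grid T n (Suc i)) - x (grid T n i))) \<in> borel_measurable (wiener T)" for n
    by (intro borel_measurable_sum borel_measurable_times borel_measurable_diff measurable_eval_wiener[OF wiener(3,2)[OF T]]) auto
qed

text \<open>The combination is the stochastic integral of the single function g. The variances of
  its approximating sums are Riemann sums of the square of g, and orthonormality evaluates the
  limiting integral.\<close>

lemma char_rs_int:
  assumes T: "T > 0"
  shows "(LINT x|wiener T. iexp (\<Sum>j<N. c j * rs_int T j x)) = complex_of_real (exp (- (\<Sum>j<N. (c j)\<^sup>2) / 2))"
proof -
  interpret prob_space "wiener T" by (rule wiener(1)[OF T])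
  define g where "g t = (\<Sum>j<N. c j * cosb T j t)" for t
  have gc: "continuous_on A g" for A unfolding g_def by (intro continuous_intros continuous_cosb)
  have ev: "(\<lambda>x. x t) \<in> borel_measurable (wiener T)" for t by (rule measurable_eval_wiener[OF wiener(3,2)[OF T]])
  define Y where "Y n x = (\<Sum>i<Suc n. g (grid T n (Suc i)) * (x (grid T n (Suc i)) - x (grid T n i)))" for n and x :: "real \<Rightarrow> real"
  show ?thesis
  proof (rule char_limit[where Y=Y and v="\<lambda>n. \<Sum>i<Suc n. (g (grid T n (Suc i)) * sqrt (grid T n (Suc i) - grid T n i))\<^sup>2"])
    show "random_variable borel (Y n)" for n
      unfolding Y_def by (intro borel_measurable_sum borel_measurable_times borel_measurable_diff ev) auto
    show "random_variable borel (\<lambda>x. \<Sum>j<N. c j * rs_int T j x)"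
      by (intro borel_measurable_sum borel_measurable_times measurable_rs_int[OF T]) auto
    show "AE x in wiener T. (\<lambda>n. Y n x) \<longlonglongrightarrow> (\<Sum>j<N. c j * rs_int T j x)"
    proof (rule AE_I2)
      fix x assume "x \<in> space (wiener T)"
      then have x: "x \<in> C0 T" by (simp add: wiener(2)[OF T])
      have "Y n x = (\<Sum>j<N. c j * (\<Sum>i<Suc n. cosb T j (grid T n (Suc i)) * (x (grid T n (Suc i)) - x (grid T n i))))" for n
        unfolding Y_def g_def sum_distrib_right sum_distrib_left
        by (subst sum.swap) (simp only: mult.assoc)
      then show "(\<lambda>n. Y n x) \<longlonglongrightarrow> (\<Sum>j<N. c j * rs_int T j x)"
        by (simp only:) (intro tendsto_sum tendsto_mult tendsto_const rs_int_limit[OF T x])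
    qed
    show "expectation (\<lambda>x. iexp (Y n x)) = complex_of_real (exp (- (\<Sum>i<Suc n. (g (grid T n (Suc i)) * sqrt (grid T n (Suc i) - grid T n i))\<^sup>2) / 2))" for n
    proof -
      have "indep_vars (\<lambda>_. borel) (\<lambda>i x. x (grid T n (Suc i)) - x (grid T n i)) {..<Suc n}"
        "\<forall>i<Suc n. distributed (wiener T) lborel (\<lambda>x. x (grid T n (Suc i)) - x (grid T n i))
                   (\<lambda>r. ennreal (normal_density 0 (sqrt (grid T n (Suc i) - grid T n i)) r))"
        using wiener(4)[OF T, unfolded bm_property_def, rule_format, of "grid T n" "Suc n"] grid_less[OF T] by auto
      then show ?thesis
        unfolding Y_def using grid_less[OF T] by (intro char_indep_normal) auto
    qed
    have "(g (grid T n (Suc i)) * sqrt (grid T n (Suc i) - grid T n i))\<^sup>2 = (g (grid T n (Suc i)))\<^sup>2 * (grid T n (Suc i) - grid T n i)" for n i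
      using less_imp_le[OF grid_less[OF T]] by (simp add: power_mult_distrib)
    moreover have "((\<lambda>t. (g t)\<^sup>2) has_integral (\<Sum>j<N. (c j)\<^sup>2)) {0..T}"
    proof -
      have "((\<lambda>t. \<Sum>i<N. \<Sum>j<N. c i * c j * (cosb T i t * cosb T j t)) has_integral
           (\<Sum>i<N. \<Sum>j<N. c i * c j * (if i = j then 1 else 0))) {0..T}"
        by (intro has_integral_sum has_integral_mult_right cosb_orthonormal T) auto
      moreover have "(\<Sum>i<N. \<Sum>j<N. c i * c j * (cosb T i t * cosb T j t)) = (g t)\<^sup>2" for t
        unfolding g_def power2_eq_square sum_product by (simp add: mult_ac)
      moreover have "(\<Sum>i<N. \<Sum>j<N. c i * c j * (if i = j then 1 else 0)) = (\<Sum>j<N. (c j)\<^sup>2)"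
        by (intro sum.cong refl) (simp add: power2_eq_square if_distrib[of "\<lambda>z. _ * z"] cong: if_cong)
      ultimately show ?thesis by simp
    qed
    ultimately show "(\<lambda>n. \<Sum>i<Suc n. (g (grid T n (Suc i)) * sqrt (grid T n (Suc i) - grid T n i))\<^sup>2) \<longlonglongrightarrow> (\<Sum>j<N. (c j)\<^sup>2)"
      using riemann_sum_limit[OF T, of "\<lambda>t. (g t)\<^sup>2"] by (simp add: integral_unique continuous_on_power gc del: sum.lessThan_Suc)
  qed
qed

section \<open>Parseval's identity for the cosine basis\<close>

definition sq_int :: "'a measure \<Rightarrow> ('a \<Rightarrow> real) \<Rightarrow> bool" where
  "sq_int M f \<longleftrightarrow> f \<in> borel_measurable M \<and> integrable M (\<lambda>x. (f x)\<^sup>2)"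

lemma sq_int_mult:
  assumes "sq_int M f" "sq_int M g"
  shows "integrable M (\<lambda>x. f x * g x)"
proof (rule Bochner_Integration.integrable_bound)
  show "integrable M (\<lambda>x. (f x)\<^sup>2 + (g x)\<^sup>2)" using assms by (simp add: sq_int_def)
  show "AE x in M. norm (f x * g x) \<le> norm ((f x)\<^sup>2 + (g x)\<^sup>2)"
  proof (rule AE_I2)
    fix x
    have "2 * \<bar>f x\<bar> * \<bar>g x\<bar> \<le> \<bar>f x\<bar>\<^sup>2 + \<bar>g x\<bar>\<^sup>2" by (rule sum_squares_bound)
    moreover have "0 \<le> \<bar>f x\<bar> * \<bar>g x\<bar>" by simp
    ultimately have "\<bar>f x\<bar> * \<bar>g x\<bar> \<le> (f x)\<^sup>2 + (g x)\<^sup>2" by (simp only: mult.assoc power2_abs)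
    then show "norm (f x * g x) \<le> norm ((f x)\<^sup>2 + (g x)\<^sup>2)" by (simp add: abs_mult)
  qed
qed (use assms in \<open>auto simp: sq_int_def\<close>)

lemma sq_int_cmult: "sq_int M f \<Longrightarrow> sq_int M (\<lambda>x. c * f x)"
  by (auto simp: sq_int_def power_mult_distrib)

lemma sq_int_add: "sq_int M f \<Longrightarrow> sq_int M g \<Longrightarrow> sq_int M (\<lambda>x. f x + g x)"
  using sq_int_mult[of M f g] by (auto simp: sq_int_def power2_sum mult.assoc)

lemma sq_int_diff: "sq_int M f \<Longrightarrow> sq_int M g \<Longrightarrow> sq_int M (\<lambda>x. f x - g x)"
  using sq_int_add[of M f "\<lambda>x. -1 * g x"] sq_int_cmult[of M g "-1"] by simp

lemma sq_int_sum: "(\<And>i. i \<in> I \<Longrightarrow> sq_int M (f i)) \<Longrightarrow> sq_int M (\<lambda>x. \<Sum>i\<in>I. f i x)"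
  by (induction I rule: infinite_finite_induct) (auto simp: sq_int_add, auto simp: sq_int_def)

locale orthonormal_seq =
  fixes M :: "'a measure" and e :: "nat \<Rightarrow> 'a \<Rightarrow> real"
  assumes sq_int_e: "sq_int M (e j)"
    and orthonormal: "(LINT x|M. e i x * e j x) = (if i = j then 1 else 0)"
begin

text \<open>Membership in the closed linear span. It carries this meaning only together with
  \<open>sq_int M f\<close>, because the integral of a non-integrable function is 0.\<close>

definition approximable :: "('a \<Rightarrow> real) \<Rightarrow> bool" where
  "approximable f \<longleftrightarrow> (\<forall>\<epsilon>>0. \<exists>N b. (LINT x|M. (f x - (\<Sum>j<N. b j * e j x))\<^sup>2) < \<epsilon>)"

lemma sq_int_comb: "sq_int M (\<lambda>x. \<Sum>j<N. b j * e j x)" for N :: nat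
  by (intro sq_int_sum sq_int_cmult sq_int_e)

text \<open>Completing the square in b. With b the Fourier coefficients this contains Bessel's
  inequality; for any other b the last sum is nonnegative, so no combination of the same length
  comes closer to f.\<close>

lemma dist_expand:
  assumes f: "sq_int M f"
  shows "(LINT x|M. (f x - (\<Sum>j<N. b j * e j x))\<^sup>2)
    = (LINT x|M. (f x)\<^sup>2) - (\<Sum>j<N. (LINT x|M. f x * e j x)\<^sup>2) + (\<Sum>j<N. (b j - (LINT x|M. f x * e j x))\<^sup>2)"
proof -
  let ?S = "\<lambda>x. \<Sum>j<N. b j * e j x" and ?c = "\<lambda>j. (LINT x|M. f x * e j x)"
  have fe: "integrable M (\<lambda>x. f x * e j x)" for j by (intro sq_int_mult f sq_int_e)
  have ee: "integrable M (\<lambda>x. e i x * e j x)" for i j by (intro sq_int_mult sq_int_e)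
  have fS: "(LINT x|M. f x * ?S x) = (\<Sum>j<N. b j * ?c j)"
  proof -
    have "(LINT x|M. f x * ?S x) = (LINT x|M. (\<Sum>j<N. b j * (f x * e j x)))"
      by (simp add: sum_distrib_left mult_ac)
    then show ?thesis using fe by simp
  qed
  have SS: "(LINT x|M. ?S x * ?S x) = (\<Sum>j<N. (b j)\<^sup>2)"
  proof -
    have "(LINT x|M. ?S x * ?S x) = (LINT x|M. (\<Sum>i<N. \<Sum>j<N. b i * b j * (e i x * e j x)))"
      by (simp add: sum_product mult_ac)
    also have "\<dots> = (\<Sum>i<N. \<Sum>j<N. b i * b j * (if i = j then 1 else 0))"
      using ee by (simp add: orthonormal)
    also have "\<dots> = (\<Sum>j<N. (b j)\<^sup>2)"
      by (intro sum.cong refl) (simp add: power2_eq_square if_distrib[of "\<lambda>z. _ * z"] cong: if_cong)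
    finally show ?thesis .
  qed
  have "(LINT x|M. (f x - ?S x)\<^sup>2) = (LINT x|M. (f x)\<^sup>2 - 2 * (f x * ?S x) + ?S x * ?S x)"
    by (simp add: power2_eq_square algebra_simps)
  also have "\<dots> = (LINT x|M. (f x)\<^sup>2) - 2 * (LINT x|M. f x * ?S x) + (LINT x|M. ?S x * ?S x)"
    using f sq_int_mult[OF f sq_int_comb] sq_int_mult[OF sq_int_comb sq_int_comb] by (simp add: sq_int_def)
  also have "\<dots> = (LINT x|M. (f x)\<^sup>2) - (\<Sum>j<N. (?c j)\<^sup>2) + (\<Sum>j<N. (b j - ?c j)\<^sup>2)"
    unfolding fS SS by (simp add: power2_diff sum.distrib sum_subtractf sum_distrib_left mult_ac)
  finally show ?thesis .
qed

lemma parseval: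
  assumes f: "sq_int M f" and a: "approximable f"
  shows "(\<lambda>j. (LINT x|M. f x * e j x)\<^sup>2) sums (LINT x|M. (f x)\<^sup>2)"
  unfolding sums_def
proof (rule LIMSEQ_I)
  let ?c = "\<lambda>j. (LINT x|M. f x * e j x)"
  fix r :: real assume "r > 0"
  then obtain N b where N: "(LINT x|M. (f x - (\<Sum>j<N. b j * e j x))\<^sup>2) < r"
    using a unfolding approximable_def by blast
  have le: "(\<Sum>j<n. (?c j)\<^sup>2) \<le> (LINT x|M. (f x)\<^sup>2)" for n
  proof -
    have "0 \<le> (LINT x|M. (f x - (\<Sum>j<n. ?c j * e j x))\<^sup>2)" by simp
    then show ?thesis unfolding dist_expand[OF f] by simp
  qed
  have "0 \<le> (\<Sum>j<N. (b j - ?c j)\<^sup>2)" by (intro sum_nonneg) auto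
  then have NN: "(LINT x|M. (f x)\<^sup>2) - (\<Sum>j<N. (?c j)\<^sup>2) < r" using N unfolding dist_expand[OF f] by linarith
  show "\<exists>no. \<forall>n\<ge>no. norm ((\<Sum>j<n. (?c j)\<^sup>2) - (LINT x|M. (f x)\<^sup>2)) < r"
  proof (intro exI allI impI)
    fix n assume "n \<ge> N"
    then have "(\<Sum>j<N. (?c j)\<^sup>2) \<le> (\<Sum>j<n. (?c j)\<^sup>2)" by (intro sum_mono2) auto
    then show "norm ((\<Sum>j<n. (?c j)\<^sup>2) - (LINT x|M. (f x)\<^sup>2)) < r" using NN le[of n] by simp
  qed
qed

lemma approximable_limit:
  assumes f: "sq_int M f" and g: "\<And>n. sq_int M (g n)" "\<And>n. approximable (g n)"
    and lim: "(\<lambda>n. LINT x|M. (f x - g n x)\<^sup>2) \<longlonglongrightarrow> 0"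
  shows "approximable f"
  unfolding approximable_def
proof (intro allI impI)
  fix \<epsilon> :: real assume "\<epsilon> > 0"
  then have "\<forall>\<^sub>F n in sequentially. (LINT x|M. (f x - g n x)\<^sup>2) < \<epsilon> / 4"
    by (intro order_tendstoD[OF lim]) simp
  then obtain n where n: "(LINT x|M. (f x - g n x)\<^sup>2) < \<epsilon> / 4" by (auto simp: eventually_sequentially)
  obtain N b where N: "(LINT x|M. (g n x - (\<Sum>j<N. b j * e j x))\<^sup>2) < \<epsilon> / 4"
    using g(2)[of n] \<open>\<epsilon> > 0\<close> unfolding approximable_def by (meson divide_pos_pos zero_less_numeral)
  let ?S = "\<lambda>x. \<Sum>j<N. b j * e j x"
  have 1: "integrable M (\<lambda>x. (f x - g n x)\<^sup>2)" "integrable M (\<lambda>x. (g n x - ?S x)\<^sup>2)" "integrable M (\<lambda>x. (f x - ?S x)\<^sup>2)"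
    using sq_int_diff[OF f g(1)] sq_int_diff[OF g(1) sq_int_comb] sq_int_diff[OF f sq_int_comb] by (auto simp: sq_int_def)
  have "(LINT x|M. (f x - ?S x)\<^sup>2) \<le> (LINT x|M. 2 * (f x - g n x)\<^sup>2 + 2 * (g n x - ?S x)\<^sup>2)"
  proof (rule integral_mono)
    fix x
    \<comment> \<open>The inequality (a + b)^2 <= 2 * a^2 + 2 * b^2, the reason for asking both
      errors to be below \<epsilon> / 4.\<close>
    have "0 \<le> ((f x - g n x) - (g n x - ?S x))\<^sup>2" by simp
    then show "(f x - ?S x)\<^sup>2 \<le> 2 * (f x - g n x)\<^sup>2 + 2 * (g n x - ?S x)\<^sup>2"
      by (simp add: power2_eq_square algebra_simps)
  qed (use 1 in auto)
  also have "\<dots> < \<epsilon>" using 1 n N by simp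
  finally show "\<exists>N b. (LINT x|M. (f x - (\<Sum>j<N. b j * e j x))\<^sup>2) < \<epsilon>" by blast
qed

end

section \<open>Density of cosine polynomials in the continuous functions\<close>

inductive_set cos_polys :: "real \<Rightarrow> (real \<Rightarrow> real) set" for T where
  base: "(\<lambda>t. c * cos (real j * pi * t / T)) \<in> cos_polys T"
| add: "f \<in> cos_polys T \<Longrightarrow> g \<in> cos_polys T \<Longrightarrow> (\<lambda>t. f t + g t) \<in> cos_polys T"

text \<open>Product-to-sum keeps products inside the span. Since cosine is even, the difference of
  frequencies may be replaced by its absolute value, which is again a natural number.\<close>

lemma cos_polys_base_mult:
  "(\<lambda>t. (c * cos (real i * pi * t / T)) * (d * cos (real j * pi * t / T))) \<in> cos_polys T"
proof -
  have "cos (real i * pi * t / T) * cos (real j * pi * t / T)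
     = (cos (real (nat \<bar>int i - int j\<bar>) * pi * t / T) + cos (real (i + j) * pi * t / T)) / 2" for t
  proof -
    have "cos (real (nat \<bar>int i - int j\<bar>) * pi * t / T) = cos (real i * pi * t / T - real j * pi * t / T)"
    proof (cases "i \<le> j")
      case True
      then have "real (nat \<bar>int i - int j\<bar>) = real j - real i" by simp
      then have "cos (real (nat \<bar>int i - int j\<bar>) * pi * t / T) = cos (- (real i * pi * t / T - real j * pi * t / T))"
        by (simp only:) (simp add: algebra_simps diff_divide_distrib)
      then show ?thesis by (simp only: cos_minus)
    next
      case False
      then have "real (nat \<bar>int i - int j\<bar>) = real i - real j" by simp
      then show ?thesis by (simp only:) (simp add: algebra_simps diff_divide_distrib)
    qed
    then show ?thesis unfolding cos_times_cos by (simp add: algebra_simps add_divide_distrib)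
  qed
  then have "(\<lambda>t. (c * cos (real i * pi * t / T)) * (d * cos (real j * pi * t / T)))
    = (\<lambda>t. (c * d / 2) * cos (real (nat \<bar>int i - int j\<bar>) * pi * t / T) + (c * d / 2) * cos (real (i + j) * pi * t / T))"
  proof (intro ext)
    fix t
    assume H: "\<And>t. cos (real i * pi * t / T) * cos (real j * pi * t / T)
     = (cos (real (nat \<bar>int i - int j\<bar>) * pi * t / T) + cos (real (i + j) * pi * t / T)) / 2"
    have "(c * cos (real i * pi * t / T)) * (d * cos (real j * pi * t / T)) = c * d * (cos (real i * pi * t / T) * cos (real j * pi * t / T))"
      by (simp only: mult_ac)
    then show "(c * cos (real i * pi * t / T)) * (d * cos (real j * pi * t / T))
      = (c * d / 2) * cos (real (nat \<bar>int i - int j\<bar>) * pi * t / T) + (c * d / 2) * cos (real (i + j) * pi * t / T)"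
      unfolding H by (simp only: distrib_left times_divide_eq_right times_divide_eq_left add_divide_distrib)
  qed
  then show ?thesis by (simp only:) (intro cos_polys.intros)
qed

lemma cos_polys_mult:
  assumes "f \<in> cos_polys T" "g \<in> cos_polys T"
  shows "(\<lambda>t. f t * g t) \<in> cos_polys T"
  using assms(1)
proof induction
  case (base c i)
  show ?case using assms(2)
  proof induction
    case (base d j)
    show ?case by (rule cos_polys_base_mult)
  next
    case (add f g)
    then show ?case using cos_polys.add[OF add.IH] by (simp add: distrib_left)
  qed
next
  case (add f1 f2)
  then show ?case using cos_polys.add[OF add.IH] by (simp add: distrib_right)
qed

lemma cos_polys_eq_cosb:
  assumes T: "T > 0" and "f \<in> cos_polys T"
  shows "\<exists>(N::nat) b. \<forall>t. f t = (\<Sum>j<N. b j * cosb T j t)"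
  using assms(2)
proof induction
  case (base c j)
  obtain d where d: "\<And>t. c * cos (real j * pi * t / T) = d * cosb T j t"
  proof (cases "j = 0")
    case True
    then show ?thesis using that[of "c * sqrt T"] T by (simp add: cosb_def)
  next
    case False
    then show ?thesis using that[of "c / sqrt (2 / T)"] T by (simp add: cosb_def)
  qed
  have "c * cos (real j * pi * t / T) = (\<Sum>i<Suc j. (if i = j then d else 0) * cosb T i t)" for t
    unfolding d by simp
  then show ?case by (intro exI[of _ "Suc j"] exI[of _ "\<lambda>i. if i = j then d else 0"] allI)
next
  case (add f g)
  then obtain N1 N2 :: nat and b1 b2 where 1: "\<forall>t. f t = (\<Sum>j<N1. b1 j * cosb T j t)" and 2: "\<forall>t. g t = (\<Sum>j<N2. b2 j * cosb T j t)"
    by auto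
  have pad: "(\<Sum>j<N. b j * cosb T j t) = (\<Sum>j<max N1 N2. (if j < N then b j else 0) * cosb T j t)" if "N \<le> max N1 N2" for N b t
    using that by (intro sum.mono_neutral_cong_left) auto
  have "f t + g t = (\<Sum>j<max N1 N2. ((if j < N1 then b1 j else 0) + (if j < N2 then b2 j else 0)) * cosb T j t)" for t
    unfolding 1[rule_format] 2[rule_format] pad[of N1, simplified] pad[of N2, simplified] distrib_right sum.distrib by simp
  then show ?case
    by (intro exI[of _ "max N1 N2"] exI[of _ "\<lambda>j. (if j < N1 then b1 j else 0) + (if j < N2 then b2 j else 0)"] allI)
qed

text \<open>Stone-Weierstrass. The cosine of frequency 1 already separates points, because pi * t /
  T stays in the interval from 0 to pi, where cosine is injective; this is why no sines occur in the
  basis.\<close>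

lemma cos_polys_dense:
  assumes T: "T > 0" and g: "continuous_on {0..T} g" and d: "d > 0"
  shows "\<exists>f\<in>cos_polys T. \<forall>t\<in>{0..T}. \<bar>g t - f t\<bar> < d"
proof -
  interpret function_ring_on "cos_polys T" "{0..T}"
  proof
    show "continuous_on {0..T} f" if "f \<in> cos_polys T" for f
      using that by induction (auto intro!: continuous_intros simp: divide_inverse)
    show "(\<lambda>_. c) \<in> cos_polys T" for c using cos_polys.base[of c 0 T] by simp
    show "\<exists>f\<in>cos_polys T. f s \<noteq> f t" if st: "s \<in> {0..T}" "t \<in> {0..T}" "s \<noteq> t" for s t
    proof (rule bexI[OF _ cos_polys.base[of 1 1 T]])
      have "pi * s / T \<noteq> pi * t / T" using st T by simp
      moreover have "pi * s / T \<in> {0..pi}" "pi * t / T \<in> {0..pi}" using st T by (auto simp: field_simps)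
      ultimately show "1 * cos (real 1 * pi * s / T) \<noteq> 1 * cos (real 1 * pi * t / T)"
        using cos_inj_pi[of "pi * s / T" "pi * t / T"] by auto
    qed
  qed (auto intro: cos_polys.add cos_polys_mult)
  show ?thesis by (rule Stone_Weierstrass_basic[OF g d])
qed

section \<open>From continuous to square integrable functions\<close>

lemma finite_measure_lebesgue_on_Icc: fixes T :: real shows "finite_measure (lebesgue_on {0..T})"
  by (rule finite_measure_lebesgue_on) (metis cbox_interval lmeasurable_cbox)

lemma sq_int_bounded:
  assumes "finite_measure M" "f \<in> borel_measurable M" "\<And>x. x \<in> space M \<Longrightarrow> \<bar>f x\<bar> \<le> K"
  shows "sq_int M f"
  unfolding sq_int_def
proof
  interpret finite_measure M by fact
  show "integrable M (\<lambda>x. (f x)\<^sup>2)"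
  proof (rule integrable_const_bound[where B="K\<^sup>2"])
    show "AE x in M. norm ((f x)\<^sup>2) \<le> K\<^sup>2"
    proof (rule AE_I2)
      fix x assume "x \<in> space M"
      then have "\<bar>f x\<bar> \<le> \<bar>K\<bar>" using assms(3) by fastforce
      then show "norm ((f x)\<^sup>2) \<le> K\<^sup>2" unfolding abs_le_square_iff by simp
    qed
  qed (use assms(2) in auto)
qed fact

lemma continuous_lebesgue_on_measurable:
  fixes f :: "real \<Rightarrow> real"
  assumes "continuous_on {0..T} f"
  shows "f \<in> borel_measurable (lebesgue_on {0..T})"
  by (rule continuous_imp_measurable_on_sets_lebesgue[OF assms]) auto

lemma sq_int_continuous:
  fixes f :: "real \<Rightarrow> real"
  assumes f: "continuous_on {0..T} f"
  shows "sq_int (lebesgue_on {0..T}) f"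
proof -
  obtain K where "\<And>t. t \<in> {0..T} \<Longrightarrow> \<bar>f t\<bar> \<le> K"
    using compact_imp_bounded[OF compact_continuous_image[OF f]] by (force simp: bounded_iff)
  then show ?thesis
    by (intro sq_int_bounded finite_measure_lebesgue_on_Icc continuous_lebesgue_on_measurable f) auto
qed

lemma orthonormal_cosb:
  assumes T: "T > 0"
  shows "orthonormal_seq (lebesgue_on {0..T}) (cosb T)"
proof
  show "sq_int (lebesgue_on {0..T}) (cosb T j)" for j by (intro sq_int_continuous continuous_cosb)
  show "(LINT x|lebesgue_on {0..T}. cosb T i x * cosb T j x) = (if i = j then 1 else 0)" for i j
  proof -
    have "integrable (lebesgue_on {0..T}) (\<lambda>x. cosb T i x * cosb T j x)"
      by (intro sq_int_mult sq_int_continuous continuous_cosb)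
    then have "(LINT x|lebesgue_on {0..T}. cosb T i x * cosb T j x) = integral {0..T} (\<lambda>x. cosb T i x * cosb T j x)"
      by (intro lebesgue_integral_eq_integral) auto
    then show ?thesis using integral_unique[OF cosb_orthonormal[OF T]] by simp
  qed
qed

lemma approximable_continuous:
  assumes T: "T > 0" and g: "continuous_on {0..T} g"
  shows "orthonormal_seq.approximable (lebesgue_on {0..T}) (cosb T) g"
proof -
  interpret orthonormal_seq "lebesgue_on {0..T}" "cosb T" by (rule orthonormal_cosb[OF T])
  interpret finite_measure "lebesgue_on {0..T}" by (rule finite_measure_lebesgue_on_Icc)
  show ?thesis
    unfolding approximable_def
  proof (intro allI impI)
    fix \<epsilon> :: real assume e: "\<epsilon> > 0"
    \<comment> \<open>A uniform error d has squared L2 distance at most d^2 * T = \<epsilon> /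
      2.\<close>
    define d where "d = sqrt (\<epsilon> / (2 * T))"
    have d: "d > 0" using e T by (simp add: d_def)
    obtain f where "f \<in> cos_polys T" and f: "\<And>t. t \<in> {0..T} \<Longrightarrow> \<bar>g t - f t\<bar> < d"
      using cos_polys_dense[OF T g d] by blast
    then obtain N :: nat and b where b: "\<And>t. f t = (\<Sum>j<N. b j * cosb T j t)"
      using cos_polys_eq_cosb[OF T] by blast
    have "(LINT t|lebesgue_on {0..T}. (g t - (\<Sum>j<N. b j * cosb T j t))\<^sup>2) \<le> (LINT t|lebesgue_on {0..T}. d\<^sup>2)"
    proof (rule integral_mono)
      show "integrable (lebesgue_on {0..T}) (\<lambda>t. (g t - (\<Sum>j<N. b j * cosb T j t))\<^sup>2)"
        using sq_int_diff[OF sq_int_continuous[OF g] sq_int_comb] by (auto simp: sq_int_def)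
      show "(g t - (\<Sum>j<N. b j * cosb T j t))\<^sup>2 \<le> d\<^sup>2" if "t \<in> space (lebesgue_on {0..T})" for t
        using f[of t] that d unfolding b by (intro abs_le_square_iff[THEN iffD1]) auto
    qed auto
    also have "\<dots> = d\<^sup>2 * T" using T by (simp add: measure_restrict_space)
    also have "\<dots> < \<epsilon>" using e T by (simp add: d_def)
    finally show "\<exists>N b. (LINT t|lebesgue_on {0..T}. (g t - (\<Sum>j<N. b j * cosb T j t))\<^sup>2) < \<epsilon>" by blast
  qed
qed

text \<open>A measurable function is an almost everywhere limit of continuous ones. Clipping these
  at K and -K leaves the limit unchanged and supplies a constant dominating function on a set of
  finite measure.\<close>

lemma approximable_bounded:
  assumes T: "T > 0" and v: "v \<in> borel_measurable (lebesgue_on {0..T})" and K: "\<And>t. \<bar>v t\<bar> \<le> K"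
  shows "orthonormal_seq.approximable (lebesgue_on {0..T}) (cosb T) v"
proof -
  interpret orthonormal_seq "lebesgue_on {0..T}" "cosb T" by (rule orthonormal_cosb[OF T])
  interpret finite_measure "lebesgue_on {0..T}" by (rule finite_measure_lebesgue_on_Icc)
  have "v measurable_on {0..T}"
    using v by (subst measurable_on_iff_borel_measurable) auto
  then obtain Z g where Z: "negligible Z" and g: "\<And>n. continuous_on UNIV (g n)"
    and lim: "\<And>t. t \<notin> Z \<Longrightarrow> (\<lambda>n. g n t) \<longlonglongrightarrow> (if t \<in> {0..T} then v t else 0)"
    unfolding measurable_on_def by blast
  define h where "h n t = min K (max (- K) (g n t))" for n t
  have h: "continuous_on {0..T} (h n)" for n
    unfolding h_def by (intro continuous_intros continuous_on_subset[OF g]) auto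
  have K0: "K \<ge> 0" using K[of 0] by linarith
  have hK: "\<bar>h n t\<bar> \<le> K" for n t using K0 by (auto simp: h_def)
  have hl: "(\<lambda>n. h n t) \<longlonglongrightarrow> v t" if "t \<notin> Z" "t \<in> {0..T}" for t
  proof -
    have "(\<lambda>n. h n t) \<longlonglongrightarrow> min K (max (- K) (v t))"
      unfolding h_def using lim[of t] that by (intro tendsto_intros) auto
    moreover have "min K (max (- K) (v t)) = v t" using K[of t] by auto
    ultimately show ?thesis by simp
  qed
  have ae: "AE t in lebesgue_on {0..T}. t \<notin> Z"
  proof -
    have "AE t in lebesgue. t \<notin> Z" using Z by (intro AE_not_in) (simp add: negligible_iff_null_sets)
    then show ?thesis by (subst AE_restrict_space_iff) auto
  qed
  show ?thesis
  proof (rule approximable_limit[where g=h])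
    show "sq_int (lebesgue_on {0..T}) v" by (rule sq_int_bounded[OF finite_measure_lebesgue_on_Icc v K])
    show "sq_int (lebesgue_on {0..T}) (h n)" for n by (intro sq_int_continuous h)
    show "approximable (h n)" for n by (intro approximable_continuous T h)
    have "(\<lambda>n. LINT t|lebesgue_on {0..T}. (v t - h n t)\<^sup>2) \<longlonglongrightarrow> (LINT t|lebesgue_on {0..T}. 0)"
    proof (rule integral_dominated_convergence[where w="\<lambda>_. (2 * K)\<^sup>2"])
      show "(\<lambda>t. (v t - h n t)\<^sup>2) \<in> borel_measurable (lebesgue_on {0..T})" for n
        using v continuous_lebesgue_on_measurable[OF h] by (intro borel_measurable_power borel_measurable_diff)
      show "AE t in lebesgue_on {0..T}. (\<lambda>n. (v t - h n t)\<^sup>2) \<longlonglongrightarrow> 0"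
        using ae AE_space
      proof eventually_elim
        case (elim t)
        then have "(\<lambda>n. (v t - h n t)\<^sup>2) \<longlonglongrightarrow> (v t - v t)\<^sup>2" by (intro tendsto_intros hl) auto
        then show ?case by simp
      qed
      show "AE t in lebesgue_on {0..T}. norm ((v t - h n t)\<^sup>2) \<le> (2 * K)\<^sup>2" for n
      proof (rule AE_I2)
        fix t
        have "\<bar>v t - h n t\<bar> \<le> \<bar>2 * K\<bar>" using K[of t] hK[of n t] by linarith
        then show "norm ((v t - h n t)\<^sup>2) \<le> (2 * K)\<^sup>2" unfolding abs_le_square_iff by simp
      qed
    qed auto
    then show "(\<lambda>n. LINT t|lebesgue_on {0..T}. (v t - h n t)\<^sup>2) \<longlonglongrightarrow> 0" by simp
  qed
qed

text \<open>Truncation at height n: at each point the error is eventually zero, and its square never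
  exceeds that of v.\<close>

lemma approximable_sq_int:
  assumes T: "T > 0" and v: "sq_int (lebesgue_on {0..T}) v"
  shows "orthonormal_seq.approximable (lebesgue_on {0..T}) (cosb T) v"
proof -
  interpret orthonormal_seq "lebesgue_on {0..T}" "cosb T" by (rule orthonormal_cosb[OF T])
  define h where "h n t = min (real n) (max (- real n) (v t))" for n t
  have vm: "v \<in> borel_measurable (lebesgue_on {0..T})" using v by (simp add: sq_int_def)
  have hm: "h n \<in> borel_measurable (lebesgue_on {0..T})" for n
    unfolding h_def using vm by (intro borel_measurable_min borel_measurable_max) auto
  have hK: "\<bar>h n t\<bar> \<le> real n" for n t by (auto simp: h_def)
  have hv: "\<bar>v t - h n t\<bar> \<le> \<bar>v t\<bar>" for n t by (auto simp: h_def)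
  show ?thesis
  proof (rule approximable_limit[OF v, where g=h])
    show "sq_int (lebesgue_on {0..T}) (h n)" for n by (rule sq_int_bounded[OF finite_measure_lebesgue_on_Icc hm hK])
    show "approximable (h n)" for n by (rule approximable_bounded[OF T hm hK])
    have "(\<lambda>n. LINT t|lebesgue_on {0..T}. (v t - h n t)\<^sup>2) \<longlonglongrightarrow> (LINT t|lebesgue_on {0..T}. 0)"
    proof (rule integral_dominated_convergence[where w="\<lambda>t. (v t)\<^sup>2"])
      show "(\<lambda>t. (v t - h n t)\<^sup>2) \<in> borel_measurable (lebesgue_on {0..T})" for n
        using vm hm by (intro borel_measurable_power borel_measurable_diff)
      show "AE t in lebesgue_on {0..T}. (\<lambda>n. (v t - h n t)\<^sup>2) \<longlonglongrightarrow> 0"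
      proof (rule AE_I2)
        fix t
        obtain n0 :: nat where n0: "\<bar>v t\<bar> \<le> real n0" using real_arch_simple by blast
        have "\<forall>\<^sub>F n in sequentially. (v t - h n t)\<^sup>2 = 0"
          using eventually_ge_at_top[of n0] by eventually_elim (use n0 in \<open>auto simp: h_def\<close>)
        then show "(\<lambda>n. (v t - h n t)\<^sup>2) \<longlonglongrightarrow> 0" by (rule tendsto_eventually)
      qed
      show "AE t in lebesgue_on {0..T}. norm ((v t - h n t)\<^sup>2) \<le> (v t)\<^sup>2" for n
      proof (rule AE_I2)
        show "norm ((v t - h n t)\<^sup>2) \<le> (v t)\<^sup>2" for t using hv[of t n] unfolding abs_le_square_iff by simp
      qed
    qed (use v in \<open>auto simp: sq_int_def\<close>)
    then show "(\<lambda>n. LINT t|lebesgue_on {0..T}. (v t - h n t)\<^sup>2) \<longlonglongrightarrow> 0" by simp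
  qed
qed

lemma set_lebesgue_integral_lebesgue_on:
  "(LINT t:{0..T}|lebesgue. f t) = (LINT t|lebesgue_on {0..T}. f t)" for f :: "real \<Rightarrow> real"
  unfolding set_lebesgue_integral_def by (subst integral_restrict_space) auto

lemma in_L2_iff: "in_L2 T v \<longleftrightarrow> sq_int (lebesgue_on {0..T}) v"
  unfolding in_L2_def sq_int_def set_borel_measurable_def set_integrable_def
  by (simp add: borel_measurable_restrict_space_iff integrable_restrict_space)

text \<open>Polarisation of the quadratic identity, applied to v + w and v - w.\<close>

theorem parseval_cosb:
  assumes T: "T > 0" and v: "in_L2 T v" and w: "in_L2 T w"
  shows "(\<lambda>j. l2_coeff T v j * l2_coeff T w j) sums (LINT t:{0..T}|lebesgue. v t * w t)"
proof -
  let ?M = "lebesgue_on {0..T}"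
  interpret orthonormal_seq ?M "cosb T" by (rule orthonormal_cosb[OF T])
  have v': "sq_int ?M v" and w': "sq_int ?M w" using v w by (auto simp: in_L2_iff)
  have P: "(\<lambda>j. (LINT t|?M. f t * cosb T j t)\<^sup>2) sums (LINT t|?M. (f t)\<^sup>2)" if "sq_int ?M f" for f
    by (intro parseval approximable_sq_int T that)
  have iv: "integrable ?M (\<lambda>t. v t * cosb T j t)" "integrable ?M (\<lambda>t. w t * cosb T j t)" for j
    using sq_int_mult v' w' sq_int_e by blast+
  have i2: "integrable ?M (\<lambda>t. (v t)\<^sup>2)" "integrable ?M (\<lambda>t. (w t)\<^sup>2)" "integrable ?M (\<lambda>t. v t * w t)"
    using v' w' sq_int_mult[OF v' w'] by (auto simp: sq_int_def)
  have "(\<lambda>j. ((LINT t|?M. (v t + w t) * cosb T j t)\<^sup>2 - (LINT t|?M. (v t - w t) * cosb T j t)\<^sup>2) / 4)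
     sums (((LINT t|?M. (v t + w t)\<^sup>2) - (LINT t|?M. (v t - w t)\<^sup>2)) / 4)"
    by (intro sums_divide sums_diff P sq_int_add sq_int_diff v' w')
  moreover have "((LINT t|?M. (v t + w t) * cosb T j t)\<^sup>2 - (LINT t|?M. (v t - w t) * cosb T j t)\<^sup>2) / 4
     = l2_coeff T v j * l2_coeff T w j" for j
    unfolding l2_coeff_def set_lebesgue_integral_lebesgue_on using iv
    by (simp add: distrib_right left_diff_distrib power2_sum power2_diff)
  moreover have "((LINT t|?M. (v t + w t)\<^sup>2) - (LINT t|?M. (v t - w t)\<^sup>2)) / 4 = (LINT t|?M. v t * w t)"
    using i2 by (simp add: power2_sum power2_diff mult.assoc)
  ultimately show ?thesis unfolding set_lebesgue_integral_lebesgue_on by simp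
qed

section \<open>The Paley--Wiener--Zygmund integral\<close>

text \<open>Independence concerns finite subfamilies only, and a finite set of naturals lies in an
  initial segment.\<close>

lemma (in prob_space) indep_vars_UNIV_nat:
  assumes "\<And>k::nat. indep_vars M' X {..<k}"
  shows "indep_vars M' X UNIV"
  unfolding indep_vars_def2
proof
  show "\<forall>i\<in>UNIV. random_variable (M' i) (X i)"
    using assms[of "Suc _"] unfolding indep_vars_def2 by auto
  show "indep_sets (\<lambda>i. {X i -` A \<inter> space M |A. A \<in> sets (M' i)}) UNIV"
  proof (subst indep_sets_finite_index_sets, intro allI impI)
    fix J :: "nat set" assume "finite J"
    then have "J \<subseteq> {..<Suc (Max J)}" by (auto simp: less_Suc_eq_le)
    then show "indep_sets (\<lambda>i. {X i -` A \<inter> space M |A. A \<in> sets (M' i)}) J"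
      using assms[of "Suc (Max J)"] unfolding indep_vars_def2 by (blast intro: indep_sets_mono_index)
  qed
qed

lemma (in prob_space) law_iid_normal:
  assumes ind: "indep_vars (\<lambda>_. borel) X (UNIV :: nat set)"
    and d: "\<And>j. distributed M lborel (X j) (normal_density 0 1)"
  shows "distr M (\<Pi>\<^sub>M _\<in>UNIV. borel) (\<lambda>x i. X i x) = gauss_seq"
proof -
  have rv: "random_variable borel (X j)" for j using distributed_measurable[OF d[of j]] by simp
  have "distr M borel (X j) = std_normal_distribution" for j
    using distributed_distr_eq_density[OF d[of j]] by (simp cong: distr_cong)
  then show ?thesis
    using indep_vars_iff_distr_eq_PiM[where I=UNIV and M'="\<lambda>_. borel" and X=X] ind rv by (simp add: restrict_UNIV)
qed

lemma pred_convergent_real: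
  fixes f :: "nat \<Rightarrow> 'a \<Rightarrow> real"
  assumes "\<And>i. f i \<in> borel_measurable M"
  shows "Measurable.pred M (\<lambda>x. convergent (\<lambda>i. f i x))"
  unfolding pred_def Cauchy_convergent_iff[symmetric] by (rule sets_Collect_Cauchy[OF assms])

text \<open>Convergence is a measurable event of the sequence, so its probability depends on the law
  alone. It may thus be proved on whichever probability space makes it easiest.\<close>

lemma (in prob_space) iid_normal_series_iff:
  assumes ind: "indep_vars (\<lambda>_. borel) X (UNIV :: nat set)"
    and d: "\<And>j. distributed M lborel (X j) (normal_density 0 1)"
  shows "(AE x in M. convergent (\<lambda>n. \<Sum>j<n. a j * X j x)) \<longleftrightarrow> (AE \<omega> in gauss_seq. convergent (\<lambda>n. \<Sum>j<n. a j * \<omega> j))"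
proof -
  have rv[measurable]: "random_variable borel (X j)" for j using distributed_measurable[OF d[of j]] by simp
  have "{\<omega> \<in> space (\<Pi>\<^sub>M _\<in>UNIV. borel). convergent (\<lambda>n. \<Sum>j<n. a j * \<omega> j)} \<in> sets (\<Pi>\<^sub>M _\<in>(UNIV::nat set). (borel::real measure))"
    by (intro predE pred_convergent_real) measurable
  then show ?thesis
    unfolding law_iid_normal[OF assms, symmetric]
    by (subst AE_distr_iff) (auto intro!: measurable_PiM_single')
qed

text \<open>For nowhere vanishing \<open>b\<close> the partial sums have the law of a Brownian path sampled at the
times \<open>\<Sum>j<n. (b j)\<^sup>2\<close>, which converge; so path continuity replaces Kolmogorov's maximal inequality.\<close>

lemma gauss_series_converges_aux:
  fixes b :: "nat \<Rightarrow> real"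
  assumes nz: "\<And>j. b j \<noteq> 0" and sm: "summable (\<lambda>j. (b j)\<^sup>2)"
  shows "AE \<omega> in gauss_seq. convergent (\<lambda>n. \<Sum>j<n. b j * \<omega> j)"
proof -
  define S where "S = (\<Sum>j. (b j)\<^sup>2)"
  define \<tau> where "\<tau> n = (\<Sum>j<n. (b j)\<^sup>2)" for n
  have S0: "S > 0" unfolding S_def using nz sm by (intro suminf_pos) auto
  have \<tau>S: "\<tau> n \<le> S" for n unfolding \<tau>_def S_def using sm by (intro sum_le_suminf) auto
  have \<tau>0: "\<tau> n \<ge> 0" for n unfolding \<tau>_def by (intro sum_nonneg) auto
  have \<tau>l: "\<tau> \<longlonglongrightarrow> S" unfolding \<tau>_def S_def by (rule summable_LIMSEQ[OF sm])
  have \<tau>d: "\<tau> (Suc j) - \<tau> j = (b j)\<^sup>2" for j by (simp add: \<tau>_def)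
  have \<tau>lt: "\<tau> j < \<tau> (Suc j)" for j using nz[of j] by (simp add: \<tau>_def)
  interpret prob_space "wiener S" by (rule wiener(1)[OF S0])
  have bm: "indep_vars (\<lambda>_. borel) (\<lambda>i x. x (\<tau> (Suc i)) - x (\<tau> i)) {..<k} \<and>
     (\<forall>i<k. distributed (wiener S) lborel (\<lambda>x. x (\<tau> (Suc i)) - x (\<tau> i))
                   (\<lambda>r. ennreal (normal_density 0 (sqrt (\<tau> (Suc i) - \<tau> i)) r)))" for k
    using wiener(4)[OF S0, unfolded bm_property_def, rule_format, of \<tau> k] \<tau>lt \<tau>S by (auto simp: \<tau>_def)
  \<comment> \<open>Division by \<open>b j\<close> itself and not by its absolute value makes the
    weighted sum telescope; the sign is harmless as the centred normal law is symmetric.\<close>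
  define Y where "Y j x = (x (\<tau> (Suc j)) - x (\<tau> j)) / b j" for j and x :: "real \<Rightarrow> real"
  have Yind: "indep_vars (\<lambda>_. borel) Y UNIV"
    unfolding Y_def
    by (rule indep_vars_compose2[where Y="\<lambda>j z. z / b j" and M'="\<lambda>_. borel"])
      (use indep_vars_UNIV_nat bm in auto)
  have Yd: "distributed (wiener S) lborel (Y j) (normal_density 0 1)" for j
  proof -
    have "distributed (wiener S) lborel (\<lambda>x. x (\<tau> (Suc j)) - x (\<tau> j)) (normal_density 0 \<bar>b j\<bar>)"
      using bm[of "Suc j"] unfolding \<tau>d by simp
    from normal_density_affine[OF this, of "1 / b j" 0] show ?thesis
      using nz[of j] by (simp add: Y_def[abs_def])
  qed
  have "AE x in wiener S. convergent (\<lambda>n. \<Sum>j<n. b j * Y j x)"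
  proof (rule AE_I2)
    fix x assume "x \<in> space (wiener S)"
    then have x: "continuous_on {0..S} x" by (simp add: wiener(2)[OF S0] C0_def)
    have "(\<Sum>j<n. b j * Y j x) = x (\<tau> n) - x (\<tau> 0)" for n
      unfolding Y_def using nz by (simp add: sum_lessThan_telescope[of "\<lambda>j. x (\<tau> j)"])
    moreover have "(\<lambda>n. x (\<tau> n) - x (\<tau> 0)) \<longlonglongrightarrow> x S - x (\<tau> 0)"
      using S0 \<tau>0 \<tau>S by (intro tendsto_intros continuous_on_tendsto_compose[OF x \<tau>l]) auto
    ultimately show "convergent (\<lambda>n. \<Sum>j<n. b j * Y j x)" by (auto simp: convergent_def)
  qed
  then show ?thesis using iid_normal_series_iff[OF Yind Yd] by simp
qed

text \<open>Vanishing coefficients would give repeated sampling times. Hence a is split into b and a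
  - b, both nowhere zero and square summable: two halves where a j is nonzero, and (1/2)^j with its
  negative where it is zero.\<close>

lemma gauss_series_converges:
  fixes a :: "nat \<Rightarrow> real"
  assumes sm: "summable (\<lambda>j. (a j)\<^sup>2)"
  shows "AE \<omega> in gauss_seq. convergent (\<lambda>n. \<Sum>j<n. a j * \<omega> j)"
proof -
  define b where "b j = (if a j = 0 then (1/2)^j else a j / 2)" for j
  have g: "summable (\<lambda>j. ((1/2::real)^j)\<^sup>2)"
    unfolding power_even_eq[symmetric] power_mult by (intro summable_geometric) (simp add: power2_eq_square)
  have bb: "(b j)\<^sup>2 \<le> ((1/2)^j)\<^sup>2 + (a j)\<^sup>2" for j by (auto simp: b_def power_divide)
  have cc: "(a j - b j)\<^sup>2 \<le> ((1/2)^j)\<^sup>2 + (a j)\<^sup>2" for j by (auto simp: b_def power_divide field_simps)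
  have "summable (\<lambda>j. (b j)\<^sup>2)" "summable (\<lambda>j. (a j - b j)\<^sup>2)"
    by (rule summable_comparison_test'[OF summable_add[OF g sm], of 0], use bb cc in auto)+
  then have "AE \<omega> in gauss_seq. convergent (\<lambda>n. \<Sum>j<n. b j * \<omega> j)"
    "AE \<omega> in gauss_seq. convergent (\<lambda>n. \<Sum>j<n. (a j - b j) * \<omega> j)"
    by (intro gauss_series_converges_aux; simp add: b_def)+
  then show ?thesis
  proof eventually_elim
    case (elim \<omega>)
    from convergent_add[OF this] show ?case by (simp add: left_diff_distrib sum.distrib[symmetric])
  qed
qed

section \<open>Convergence and joint law of PWZ integrals\<close>

definition pwz_sum :: "real \<Rightarrow> (real \<Rightarrow> real) \<Rightarrow> (real \<Rightarrow> real) \<Rightarrow> nat \<Rightarrow> real" where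
  "pwz_sum T v x n = (\<Sum>j<n. l2_coeff T v j * rs_int T j x)"

lemma pwz_eq: "pwz T v x = (if convergent (pwz_sum T v x) then lim (pwz_sum T v x) else 0)"
  by (simp add: pwz_def pwz_sum_def[abs_def] Let_def)

lemma pwz_limit: "convergent (pwz_sum T v x) \<Longrightarrow> pwz_sum T v x \<longlonglongrightarrow> pwz T v x"
  by (simp add: pwz_eq convergent_LIMSEQ_iff)

lemma measurable_pwz_sum: "T > 0 \<Longrightarrow> (\<lambda>x. pwz_sum T v x n) \<in> borel_measurable (wiener T)"
  unfolding pwz_sum_def by (intro borel_measurable_sum borel_measurable_times measurable_rs_int) auto

lemma measurable_pwz: "T > 0 \<Longrightarrow> pwz T v \<in> borel_measurable (wiener T)"
proof -
  assume T: "T > 0"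
  have [measurable]: "(\<lambda>x. pwz_sum T v x n) \<in> borel_measurable (wiener T)" for n by (rule measurable_pwz_sum[OF T])
  have [measurable]: "Measurable.pred (wiener T) (\<lambda>x. convergent (pwz_sum T v x))"
    by (rule pred_convergent_real[of "\<lambda>n x. pwz_sum T v x n"]) measurable
  have [measurable]: "(\<lambda>x. lim (pwz_sum T v x)) \<in> borel_measurable (wiener T)"
    by (rule borel_measurable_lim_metric[of "\<lambda>n x. pwz_sum T v x n"]) measurable
  show ?thesis unfolding pwz_eq[abs_def] by measurable
qed

text \<open>Parseval for the pair v, v makes the coefficients square summable, and the cosine
  integrals have the law of \<open>gauss_seq\<close>, to which convergence of Gaussian series
  applies.\<close>

lemma pwz_converges_AE:
  assumes T: "T > 0" and v: "in_L2 T v"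
  shows "AE x in wiener T. convergent (pwz_sum T v x)"
proof -
  interpret prob_space "wiener T" by (rule wiener(1)[OF T])
  have *: "indep_vars (\<lambda>_. borel) (rs_int T) {..<k}" "\<And>i. i < k \<Longrightarrow> distributed (wiener T) lborel (rs_int T i) (normal_density 0 1)" for k
    using indep_normal_if_char[of k "rs_int T" "\<lambda>_. 1"] measurable_rs_int[OF T] char_rs_int[OF T] by auto
  have i: "indep_vars (\<lambda>_. borel) (rs_int T) UNIV" by (intro indep_vars_UNIV_nat *)
  have d: "distributed (wiener T) lborel (rs_int T i) (normal_density 0 1)" for i using *(2)[of i "Suc i"] by simp
  have "summable (\<lambda>j. (l2_coeff T v j)\<^sup>2)"
    using parseval_cosb[OF T v v] by (auto simp: sums_iff power2_eq_square)
  from gauss_series_converges[OF this] show ?thesis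
    unfolding iid_normal_series_iff[OF i d, symmetric] pwz_sum_def[abs_def] .
qed

lemma pwz_iid_normal:
  assumes T: "T > 0" and \<alpha>: "orthonormal_L2 T n \<alpha>"
  shows "prob_space.indep_vars (wiener T) (\<lambda>_. borel) (\<lambda>i. pwz T (\<alpha> i)) {..<n}"
    and "\<And>i. i < n \<Longrightarrow> distributed (wiener T) lborel (pwz T (\<alpha> i)) (normal_density 0 1)"
proof -
  interpret prob_space "wiener T" by (rule wiener(1)[OF T])
  have L2: "in_L2 T (\<alpha> i)" if "i < n" for i using \<alpha> that by (simp add: orthonormal_L2_def)
  have ch: "(LINT x|wiener T. iexp (\<Sum>i<n. u i * pwz T (\<alpha> i) x)) = complex_of_real (exp (- (\<Sum>i<n. (u i * 1)\<^sup>2) / 2))" for u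
  proof -
    \<comment> \<open>The k-th cosine coefficient of the combination of the
      \<open>\<alpha> i\<close> with weights u i. Orthonormality enters through Parseval only, as
      the value of the sum of the squares of c.\<close>
    define c where "c k = (\<Sum>i<n. u i * l2_coeff T (\<alpha> i) k)" for k
    show ?thesis
    proof (rule char_limit[where Y="\<lambda>N x. \<Sum>k<N. c k * rs_int T k x" and v="\<lambda>N. \<Sum>k<N. (c k)\<^sup>2"])
      show "random_variable borel (\<lambda>x. \<Sum>k<N. c k * rs_int T k x)" for N
        by (intro borel_measurable_sum borel_measurable_times measurable_rs_int T) auto
      show "random_variable borel (\<lambda>x. \<Sum>i<n. u i * pwz T (\<alpha> i) x)"
        by (intro borel_measurable_sum borel_measurable_times measurable_pwz T) auto
      have "AE x in wiener T. \<forall>i\<in>{..<n}. convergent (pwz_sum T (\<alpha> i) x)"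
        by (intro AE_finite_allI pwz_converges_AE T L2) auto
      then show "AE x in wiener T. (\<lambda>N. \<Sum>k<N. c k * rs_int T k x) \<longlonglongrightarrow> (\<Sum>i<n. u i * pwz T (\<alpha> i) x)"
      proof eventually_elim
        case (elim x)
        have "(\<lambda>N. \<Sum>i<n. u i * pwz_sum T (\<alpha> i) x N) \<longlonglongrightarrow> (\<Sum>i<n. u i * pwz T (\<alpha> i) x)"
          using elim by (intro tendsto_sum tendsto_mult tendsto_const pwz_limit) auto
        moreover have "(\<Sum>i<n. u i * pwz_sum T (\<alpha> i) x N) = (\<Sum>k<N. c k * rs_int T k x)" for N
          unfolding pwz_sum_def c_def sum_distrib_left sum_distrib_right
          by (subst sum.swap) (simp only: mult.assoc)
        ultimately show ?case by simp
      qed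
      show "(LINT x|wiener T. iexp (\<Sum>k<N. c k * rs_int T k x)) = complex_of_real (exp (- (\<Sum>k<N. (c k)\<^sup>2) / 2))" for N
        by (rule char_rs_int[OF T])
      have "(\<lambda>k. \<Sum>i<n. \<Sum>j<n. u i * u j * (l2_coeff T (\<alpha> i) k * l2_coeff T (\<alpha> j) k))
         sums (\<Sum>i<n. \<Sum>j<n. u i * u j * (LINT t:{0..T}|lebesgue. \<alpha> i t * \<alpha> j t))"
        by (intro sums_sum sums_mult parseval_cosb T L2) auto
      moreover have "(\<Sum>i<n. \<Sum>j<n. u i * u j * (l2_coeff T (\<alpha> i) k * l2_coeff T (\<alpha> j) k)) = (c k)\<^sup>2" for k
        unfolding c_def power2_eq_square sum_product by (simp add: mult_ac)
      moreover have "(\<Sum>i<n. \<Sum>j<n. u i * u j * (LINT t:{0..T}|lebesgue. \<alpha> i t * \<alpha> j t)) = (\<Sum>i<n. (u i * 1)\<^sup>2)"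
      proof (rule sum.cong[OF refl])
        fix i assume i: "i \<in> {..<n}"
        have "(\<Sum>j<n. u i * u j * (LINT t:{0..T}|lebesgue. \<alpha> i t * \<alpha> j t)) = (\<Sum>j<n. if j = i then u i * u i else 0)"
          using \<alpha> i by (intro sum.cong refl) (auto simp: orthonormal_L2_def)
        also have "\<dots> = (u i * 1)\<^sup>2" using i by (simp add: power2_eq_square)
        finally show "(\<Sum>j<n. u i * u j * (LINT t:{0..T}|lebesgue. \<alpha> i t * \<alpha> j t)) = (u i * 1)\<^sup>2" .
      qed
      ultimately show "(\<lambda>N. \<Sum>k<N. (c k)\<^sup>2) \<longlonglongrightarrow> (\<Sum>i<n. (u i * 1)\<^sup>2)"
        unfolding sums_def by simp
    qed
  qed
  show "indep_vars (\<lambda>_. borel) (\<lambda>i. pwz T (\<alpha> i)) {..<n}"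
    by (rule indep_normal_if_char[of n _ "\<lambda>_. 1"]) (use measurable_pwz[OF T] ch in auto)
  show "distributed (wiener T) lborel (pwz T (\<alpha> i)) (normal_density 0 1)" if "i < n" for i
    by (rule indep_normal_if_char(2)[of n _ "\<lambda>_. 1"]) (use measurable_pwz[OF T] ch that in auto)
qed

section \<open>The Fourier--Feynman transform\<close>

lemma add_scale_C0: "x \<in> C0 T \<Longrightarrow> y \<in> C0 T \<Longrightarrow> add_path y (scale_path r x) \<in> C0 T"
  by (auto simp: C0_def add_path_def scale_path_def intro!: continuous_intros)

lemma scale_C0: "x \<in> C0 T \<Longrightarrow> scale_path r x \<in> C0 T"
  by (auto simp: C0_def scale_path_def intro!: continuous_intros)

lemma rs_int_linear:
  assumes T: "T > 0" and x: "x \<in> C0 T" and y: "y \<in> C0 T"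
  shows "rs_int T j (add_path y (scale_path r x)) = rs_int T j y + r * rs_int T j x"
proof -
  have xc: "continuous_on {0..T} x" and yc: "continuous_on {0..T} y" and zc: "continuous_on {0..T} (add_path y (scale_path r x))"
    using x y add_scale_C0[OF x y] by (auto simp: C0_def)
  have i: "(\<lambda>t. x t * cosb' T j t) integrable_on {0..T}" "(\<lambda>t. y t * cosb' T j t) integrable_on {0..T}"
    by (auto intro!: integrable_continuous_real continuous_intros xc yc continuous_cosb')
  have "integral {0..T} (\<lambda>t. add_path y (scale_path r x) t * cosb' T j t)
    = integral {0..T} (\<lambda>t. y t * cosb' T j t + r * (x t * cosb' T j t))"
    by (simp add: add_path_def scale_path_def algebra_simps)
  also have "\<dots> = integral {0..T} (\<lambda>t. y t * cosb' T j t) + r * integral {0..T} (\<lambda>t. x t * cosb' T j t)"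
    using i by (subst Henstock_Kurzweil_Integration.integral_add) (auto intro: integrable_on_mult_right)
  finally show ?thesis
    unfolding rs_int_eq[OF T xc] rs_int_eq[OF T yc] rs_int_eq[OF T zc]
    by (simp add: add_path_def scale_path_def algebra_simps)
qed

lemma pwz_sum_linear:
  assumes "T > 0" "x \<in> C0 T" "y \<in> C0 T"
  shows "pwz_sum T v (add_path y (scale_path r x)) n = pwz_sum T v y n + r * pwz_sum T v x n"
  by (simp add: pwz_sum_def rs_int_linear[OF assms] sum.distrib sum_distrib_left algebra_simps)

lemma pwz_sum_scale:
  assumes T: "T > 0" and x: "x \<in> C0 T"
  shows "pwz_sum T v (scale_path r x) n = r * pwz_sum T v x n"
proof -
  have z: "(\<lambda>_. 0) \<in> C0 T" by (simp add: C0_def)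
  have "rs_int T j (\<lambda>_. 0) = 0" for j by (simp add: rs_int_def)
  then have "pwz_sum T v (\<lambda>_. 0) n = 0" by (simp add: pwz_sum_def)
  then show ?thesis using pwz_sum_linear[OF T x z, of v r n] by (simp add: add_path_def)
qed

text \<open>Convergence at both paths cannot be dropped from the argument: at a path with divergent
  series \<open>pwz\<close> is the default 0 and the limit rule says nothing.\<close>

lemma pwz_linear:
  assumes "T > 0" "x \<in> C0 T" "y \<in> C0 T"
    and cx: "convergent (pwz_sum T v x)" and cy: "convergent (pwz_sum T v y)"
  shows "pwz T v (add_path y (scale_path r x)) = pwz T v y + r * pwz T v x"
proof -
  have "pwz_sum T v (add_path y (scale_path r x)) \<longlonglongrightarrow> pwz T v y + r * pwz T v x"
    unfolding pwz_sum_linear[OF assms(1-3), abs_def]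
    by (intro tendsto_intros pwz_limit cx cy)
  then show ?thesis by (auto simp: pwz_eq[of T v "add_path _ _"] convergent_def limI)
qed

text \<open>Described by divergence and not by failure of the final formula, so that the set is
  visibly stable under scaling and can be used for x and for y alike.\<close>

definition pwz_bad :: "real \<Rightarrow> nat \<Rightarrow> (nat \<Rightarrow> real \<Rightarrow> real) \<Rightarrow> (real \<Rightarrow> real) set" where
  "pwz_bad T n \<alpha> = {x \<in> C0 T. \<exists>j<n. \<not> convergent (pwz_sum T (\<alpha> j) x)}"

lemma pwz_bad_null:
  assumes T: "T > 0" and \<alpha>: "\<And>j. j < n \<Longrightarrow> in_L2 T (\<alpha> j)"
  shows "pwz_bad T n \<alpha> \<in> null_sets (wiener T)"
proof -
  have "AE x in wiener T. \<forall>j\<in>{..<n}. convergent (pwz_sum T (\<alpha> j) x)"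
    by (intro AE_finite_allI pwz_converges_AE T \<alpha>) auto
  moreover have [measurable]: "Measurable.pred (wiener T) (\<lambda>x. convergent (pwz_sum T (\<alpha> j) x))" for j
    by (rule pred_convergent_real[of "\<lambda>n x. pwz_sum T _ x n"]) (rule measurable_pwz_sum[OF T])
  have "{x \<in> space (wiener T). \<not> (\<forall>j\<in>{..<n}. convergent (pwz_sum T (\<alpha> j) x))} \<in> sets (wiener T)"
    by measurable
  ultimately have "{x \<in> space (wiener T). \<not> (\<forall>j\<in>{..<n}. convergent (pwz_sum T (\<alpha> j) x))} \<in> null_sets (wiener T)"
    by (simp only: AE_iff_null)
  moreover have "{x \<in> space (wiener T). \<not> (\<forall>j\<in>{..<n}. convergent (pwz_sum T (\<alpha> j) x))} = pwz_bad T n \<alpha>"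
    by (auto simp: pwz_bad_def wiener(2)[OF T])
  ultimately show ?thesis by simp
qed

text \<open>Scaling multiplies all partial sums by a nonzero constant. The inclusion for the factor
  1 / r gives the converse one, and a null set at one scale is then null at every scale.\<close>

lemma scale_pwz_bad:
  assumes T: "T > 0" and r: "r > 0"
  shows "scale_path r ` pwz_bad T n \<alpha> = pwz_bad T n \<alpha>"
proof -
  have sub: "scale_path r ` pwz_bad T n \<alpha> \<subseteq> pwz_bad T n \<alpha>" if r: "r > 0" for r
  proof
    fix z assume "z \<in> scale_path r ` pwz_bad T n \<alpha>"
    then obtain x j where x: "x \<in> C0 T" "j < n" "\<not> convergent (pwz_sum T (\<alpha> j) x)" and z: "z = scale_path r x"
      by (auto simp: pwz_bad_def)
    have "pwz_sum T (\<alpha> j) z = (\<lambda>n. r * pwz_sum T (\<alpha> j) x n)"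
      by (auto simp: z pwz_sum_scale[OF T x(1)])
    then have "\<not> convergent (pwz_sum T (\<alpha> j) z)" using x(3) r by (simp add: convergent_mult_const_iff)
    then show "z \<in> pwz_bad T n \<alpha>" using x scale_C0 by (auto simp: pwz_bad_def z)
  qed
  have "x \<in> scale_path r ` pwz_bad T n \<alpha>" if "x \<in> pwz_bad T n \<alpha>" for x
  proof (rule image_eqI)
    show "x = scale_path r (scale_path (1 / r) x)" using r by (simp add: scale_path_def)
    show "scale_path (1 / r) x \<in> pwz_bad T n \<alpha>" using sub[of "1 / r"] r that by auto
  qed
  then show ?thesis using sub[OF r] by auto
qed

text \<open>Checked on generators, where an evaluation of the moved path is an affine function of
  the same evaluation of x.\<close>

lemma measurable_add_scale:
  assumes T: "T > 0" and y: "y \<in> C0 T"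
  shows "(\<lambda>x. add_path y (scale_path r x)) \<in> measurable (wiener T) (wiener T)"
proof (rule measurable_sigma_sets)
  show "sets (wiener T) = sigma_sets (C0 T) {{x \<in> C0 T. x t \<in> A} | t A. t \<in> {0..T} \<and> A \<in> sets borel}"
    unfolding wiener(3)[OF T] wiener_sets_def ..
  show "(\<lambda>x. add_path y (scale_path r x)) \<in> space (wiener T) \<rightarrow> C0 T"
    using add_scale_C0[OF _ y] by (auto simp: wiener(2)[OF T])
  fix B assume "B \<in> {{x \<in> C0 T. x t \<in> A} | t A. t \<in> {0..T} \<and> A \<in> sets borel}"
  then obtain t and A :: "real set" where A: "A \<in> sets borel" and B: "B = {x \<in> C0 T. x t \<in> A}" by auto
  have [measurable]: "(\<lambda>x. x t) \<in> borel_measurable (wiener T)" by (rule measurable_eval_wiener[OF wiener(3,2)[OF T]])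
  have "(\<lambda>x. add_path y (scale_path r x)) -` B \<inter> space (wiener T) = (\<lambda>x. y t + r * x t) -` A \<inter> space (wiener T)"
    using add_scale_C0[OF _ y] by (auto simp: B wiener(2)[OF T] add_path_def scale_path_def)
  also have "\<dots> \<in> sets (wiener T)" using A by measurable
  finally show "(\<lambda>x. add_path y (scale_path r x)) -` B \<inter> space (wiener T) \<in> sets (wiener T)" .
qed auto

section \<open>Moments of a shifted Gaussian variable\<close>

lemma odd_dfact_eq: "real (odd_dfact s) = fact (2 * s) / (2 ^ s * fact s)"
proof (induction s)
  case 0
  then show ?case by (simp add: odd_dfact_def)
next
  case (Suc s)
  have "real (odd_dfact (Suc s)) = real (odd_dfact s) * (2 * real s + 1)"
    by (simp add: odd_dfact_def algebra_simps)
  also have "\<dots> = fact (2 * Suc s) / (2 ^ Suc s * fact (Suc s))"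
  proof -
    have 1: "fact (2 * Suc s) = (2 * (real s + 1)) * ((2 * real s + 1) * fact (2 * s))"
      by (simp add: algebra_simps)
    have 2: "2 ^ Suc s * fact (Suc s) = (2 * (real s + 1)) * (2 ^ s * fact s)"
      by (simp add: algebra_simps)
    show ?thesis unfolding Suc 1 2 by (subst mult_divide_mult_cancel_left) auto
  qed
  finally show ?case .
qed

lemma (in prob_space) std_normal_moments:
  assumes d: "distributed M lborel X (normal_density 0 1)"
  shows "integrable M (\<lambda>x. X x ^ k)"
    and "(LINT x|M. X x ^ (2 * s)) = odd_dfact s" and "(LINT x|M. X x ^ (2 * s + 1)) = 0"
proof -
  have *: "(LINT x|M. X x ^ m) = (LINT z|lborel. std_normal_density z * z ^ m)" for m
    using distributed_integral[OF d, of "\<lambda>z. z ^ m"] by simp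
  show "(LINT x|M. X x ^ (2 * s)) = odd_dfact s" unfolding * integral_std_normal_moment_even odd_dfact_eq ..
  show "(LINT x|M. X x ^ (2 * s + 1)) = 0" unfolding * by (rule integral_std_normal_moment_odd)
  show "integrable M (\<lambda>x. X x ^ k)"
    using distributed_integrable[OF d, of "\<lambda>z. z ^ k"] integrable_std_normal_moment[of k] by simp
qed

lemma sum_even_odd:
  fixes f :: "nat \<Rightarrow> 'a::comm_monoid_add"
  shows "(\<Sum>k\<le>2 * p. f k) = (\<Sum>s\<le>p. f (2 * s)) + (\<Sum>s<p. f (2 * s + 1))"
  by (induction p) (auto simp: add_ac)

text \<open>Odd moments vanish, so r enters only through its square. With r = 1 / sqrt l this
  removes the square root, and no branch has to be continued.\<close>

lemma (in prob_space) normal_shift_moment: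
  assumes d: "distributed M lborel X (normal_density 0 1)"
  shows "integrable M (\<lambda>x. (y + r * X x) ^ (2 * p))"
    and "(LINT x|M. (y + r * X x) ^ (2 * p)) = (\<Sum>s = 0..p. real ((2 * p) choose (2 * s)) * odd_dfact s * (r\<^sup>2) ^ s * y ^ (2 * p - 2 * s))"
proof -
  have e: "(y + r * X x) ^ (2 * p) = (\<Sum>k\<le>2 * p. (real ((2 * p) choose k) * r ^ k * y ^ (2 * p - k)) * X x ^ k)" for x
    unfolding add.commute[of y] binomial_ring by (intro sum.cong refl) (simp add: power_mult_distrib mult_ac)
  note i = std_normal_moments(1)[OF d]
  show "integrable M (\<lambda>x. (y + r * X x) ^ (2 * p))" unfolding e using i by auto
  have "(LINT x|M. (y + r * X x) ^ (2 * p)) = (\<Sum>k\<le>2 * p. (real ((2 * p) choose k) * r ^ k * y ^ (2 * p - k)) * (LINT x|M. X x ^ k))"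
    unfolding e using i by simp
  also have "\<dots> = (\<Sum>s\<le>p. (real ((2 * p) choose (2 * s)) * r ^ (2 * s) * y ^ (2 * p - 2 * s)) * odd_dfact s)"
    unfolding sum_even_odd std_normal_moments(2,3)[OF d] by simp
  also have "\<dots> = (\<Sum>s = 0..p. real ((2 * p) choose (2 * s)) * odd_dfact s * (r\<^sup>2) ^ s * y ^ (2 * p - 2 * s))"
    unfolding power_mult by (intro sum.cong) (auto simp: mult_ac)
  finally show "(LINT x|M. (y + r * X x) ^ (2 * p)) = (\<Sum>s = 0..p. real ((2 * p) choose (2 * s)) * odd_dfact s * (r\<^sup>2) ^ s * y ^ (2 * p - 2 * s))" .
qed

section \<open>Uniqueness of the analytic extension and its boundary limit\<close>

lemma anw_ext_unique:
  assumes "anw_ext T G J" "anw_ext T G J'" "Re z > 0"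
  shows "J z = J' z"
proof -
  let ?S = "{z. Re z > 0}" and ?U = "complex_of_real ` {0<..}"
  have "(\<lambda>z. J z - J' z) z = 0"
  proof (rule analytic_continuation[where f="\<lambda>z. J z - J' z" and S="?S" and U="?U" and \<xi>=1 and w=z])
    show "(\<lambda>z. J z - J' z) holomorphic_on ?S"
      using assms by (intro holomorphic_intros) (auto simp: anw_ext_def)
    show "open ?S" by (rule open_halfspace_Re_gt)
    show "connected ?S" by (intro convex_connected convex_halfspace_Re_gt)
    \<comment> \<open>Both extensions equal the same integral on the positive axis, so one
      accumulation point inside the half-plane is enough; 1 + e / 2 comes within e of the point
      1.\<close>
    show "1 islimpt ?U"
      unfolding islimpt_approachable
    proof (intro allI impI)
      fix e :: real assume "e > 0"
      have "complex_of_real (1 + e / 2) \<noteq> complex_of_real 1" using \<open>e > 0\<close> by (simp only: of_real_eq_iff)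
      moreover have "dist (complex_of_real (1 + e / 2)) (complex_of_real 1) < e"
        unfolding dist_norm of_real_diff[symmetric] norm_of_real using \<open>e > 0\<close> by simp
      moreover have "complex_of_real (1 + e / 2) \<in> ?U" using \<open>e > 0\<close> by (intro imageI) simp
      ultimately show "\<exists>x'\<in>?U. x' \<noteq> 1 \<and> dist x' 1 < e" unfolding of_real_1 by blast
    qed
    show "J w - J' w = 0" if "w \<in> ?U" for w
      using that assms by (auto simp: anw_ext_def)
  qed (use assms in auto)
  then show ?thesis by simp
qed

text \<open>\<open>anw\<close> selects some extension; uniqueness identifies its values with those
  of J on the right half-plane, and continuity of J at the boundary point supplies the limit from
  inside.\<close>

lemma has_fft1I:
  assumes ext: "anw_ext T (\<lambda>x. F (add_path y x)) J"
    and J: "isCont J (- \<i> * complex_of_real q)" "J (- \<i> * complex_of_real q) = z"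
  shows "has_fft1 T q F y z"
  unfolding has_fft1_def
proof
  show ex: "anw_exists T (\<lambda>x. F (add_path y x))" using ext unfolding anw_exists_def by blast
  have "anw_ext T (\<lambda>x. F (add_path y x)) (SOME J. anw_ext T (\<lambda>x. F (add_path y x)) J)"
    using ex unfolding anw_exists_def by (rule someI_ex)
  then have eq: "T_lambda T lam F y = J lam" if "Re lam > 0" for lam
    unfolding T_lambda_def anw_def using anw_ext_unique[OF _ ext that] by blast
  have "(J \<longlongrightarrow> z) (at (- \<i> * complex_of_real q) within {z. Re z > 0})"
    using J by (metis isCont_def tendsto_within_subset subset_UNIV)
  moreover have "\<forall>\<^sub>F lam in at (- \<i> * complex_of_real q) within {z. Re z > 0}. T_lambda T lam F y = J lam"
    using eq by (auto simp: eventually_at_filter)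
  ultimately show "((\<lambda>lam. T_lambda T lam F y) \<longlongrightarrow> z) (at (- \<i> * complex_of_real q) within {z. Re z > 0})"
    by (simp add: tendsto_cong)
qed

lemma pwz_power_integral:
  assumes T: "T > 0" and \<alpha>: "orthonormal_L2 T n \<alpha>" and y: "y \<in> C0 T - pwz_bad T n \<alpha>"
    and F: "\<And>x. F x = (\<Prod>j<n. complex_of_real (pwz T (\<alpha> j) x) ^ (2 * p j))"
  shows "integrable (wm T) (\<lambda>x. F (add_path y (scale_path r x)))" (is ?I)
    and "(LINT x|wm T. F (add_path y (scale_path r x))) = (\<Prod>j<n. \<Sum>s = 0..p j.
        of_nat ((2 * p j) choose (2 * s)) * of_nat (odd_dfact s) * complex_of_real (r\<^sup>2) ^ s
          * complex_of_real (pwz T (\<alpha> j) y) ^ (2 * p j - 2 * s))" (is ?E)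
proof -
  interpret prob_space "wiener T" by (rule wiener(1)[OF T])
  let ?X = "\<lambda>j. pwz T (\<alpha> j)"
  let ?Z = "\<lambda>j x. (?X j y + r * ?X j x) ^ (2 * p j)"
  have L2: "in_L2 T (\<alpha> i)" if "i < n" for i using \<alpha> that by (simp add: orthonormal_L2_def)
  have nb: "pwz_bad T n \<alpha> \<in> null_sets (wiener T)" by (intro pwz_bad_null T L2)
  have [measurable]: "pwz T v \<in> borel_measurable (wiener T)" for v by (rule measurable_pwz[OF T])
  have Fm: "F \<in> borel_measurable (wiener T)"
    unfolding F[abs_def] by measurable
  have m: "(\<lambda>x. F (add_path y (scale_path r x))) \<in> borel_measurable (wiener T)"
    using y by (intro measurable_compose[OF measurable_add_scale Fm] T) auto
  have rm: "(\<lambda>x. complex_of_real (\<Prod>j<n. ?Z j x)) \<in> borel_measurable (wiener T)"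
    by measurable
  \<comment> \<open>Here y is fixed in the domain of convergence and almost every x belongs to it,
    so additivity can fail only on a null set of x that depends neither on y nor on r.\<close>
  have ae: "AE x in wiener T. F (add_path y (scale_path r x)) = complex_of_real (\<Prod>j<n. ?Z j x)"
    using AE_not_in[OF nb] AE_space
  proof eventually_elim
    case (elim x)
    then have "x \<in> C0 T" "\<And>j. j < n \<Longrightarrow> convergent (pwz_sum T (\<alpha> j) x)"
      by (auto simp: pwz_bad_def wiener(2)[OF T])
    moreover have "y \<in> C0 T" "\<And>j. j < n \<Longrightarrow> convergent (pwz_sum T (\<alpha> j) y)"
      using y by (auto simp: pwz_bad_def)
    ultimately have "pwz T (\<alpha> j) (add_path y (scale_path r x)) = ?X j y + r * ?X j x" if "j < n" for j
      using that by (intro pwz_linear T) auto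
    then show ?case unfolding F by simp
  qed
  have Zi: "indep_vars (\<lambda>_. borel) ?Z {..<n}"
    by (rule indep_vars_compose2[OF pwz_iid_normal(1)[OF T \<alpha>]]) measurable
  have Zint: "integrable (wiener T) (?Z j)" if "j \<in> {..<n}" for j
    using that by (intro normal_shift_moment pwz_iid_normal[OF T \<alpha>]) auto
  have int: "integrable (wiener T) (\<lambda>x. \<Prod>j<n. ?Z j x)"
    by (rule indep_vars_integrable[OF _ Zi Zint]) auto
  \<comment> \<open>The integrand is measurable for the Borel sets already, so passing to the
    completion changes neither integrability nor the integral.\<close>
  show ?I
    unfolding wm_def integrable_completion[OF m] integrable_cong_AE[OF m rm ae]
    using int by (rule integrable_of_real)
  have "(LINT x|wm T. F (add_path y (scale_path r x))) = (LINT x|wiener T. complex_of_real (\<Prod>j<n. ?Z j x))"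
    unfolding wm_def integral_completion[OF m] by (rule integral_cong_AE[OF m rm ae])
  also have "\<dots> = complex_of_real (\<Prod>j<n. (LINT x|wiener T. ?Z j x))"
    unfolding integral_complex_of_real using indep_vars_lebesgue_integral[OF _ Zi Zint] by simp
  also have "\<dots> = complex_of_real (\<Prod>j<n. \<Sum>s = 0..p j. real ((2 * p j) choose (2 * s)) * odd_dfact s * (r\<^sup>2) ^ s * ?X j y ^ (2 * p j - 2 * s))"
    by (intro arg_cong[of _ _ complex_of_real] prod.cong refl normal_shift_moment pwz_iid_normal[OF T \<alpha>]) auto
  finally show ?E by simp
qed

theorem theorem2:
  fixes T q :: real and n :: nat and \<alpha> :: "nat \<Rightarrow> real \<Rightarrow> real" and p :: "nat \<Rightarrow> nat"
    and F :: "(real \<Rightarrow> real) \<Rightarrow> complex"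
  assumes "T > 0"
    and "orthonormal_L2 T n \<alpha>"
    and "\<And>x. F x = (\<Prod>j<n. complex_of_real (pwz T (\<alpha> j) x) ^ (2 * p j))"
    and "q \<noteq> 0"
  shows "\<exists>N. si_null T N \<and>
           (\<forall>y \<in> C0 T - N. has_fft1 T q F y
              (\<Prod>j<n. \<Sum>s = 0..p j.
                  of_nat ((2 * p j) choose (2 * s)) * of_nat (odd_dfact s)
                  * (\<i> / complex_of_real q) ^ s
                  * complex_of_real (pwz T (\<alpha> j) y) ^ (2 * p j - 2 * s)))"
proof (intro exI conjI ballI)
  show "si_null T (pwz_bad T n \<alpha>)"
    using pwz_bad_null[of T n \<alpha>] assms(1,2)
    by (auto simp: si_null_def scale_pwz_bad wm_def orthonormal_L2_def intro: null_sets_completionI)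
  fix y assume y: "y \<in> C0 T - pwz_bad T n \<alpha>"
  \<comment> \<open>Read off from the integral at r = 1 / sqrt l, with 1 / lam in the place of the
    square of r.\<close>
  define J where "J lam = (\<Prod>j<n. \<Sum>s = 0..p j. of_nat ((2 * p j) choose (2 * s)) * of_nat (odd_dfact s)
      * (1 / lam) ^ s * complex_of_real (pwz T (\<alpha> j) y) ^ (2 * p j - 2 * s))" for lam :: complex
  show "has_fft1 T q F y (\<Prod>j<n. \<Sum>s = 0..p j. of_nat ((2 * p j) choose (2 * s)) * of_nat (odd_dfact s)
                  * (\<i> / complex_of_real q) ^ s * complex_of_real (pwz T (\<alpha> j) y) ^ (2 * p j - 2 * s))"
  proof (rule has_fft1I)
    show "anw_ext T (\<lambda>x. F (add_path y x)) J"
      unfolding anw_ext_def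
    proof (intro conjI allI impI)
      show "integrable (wm T) (\<lambda>x. F (add_path y (scale_path (1 / sqrt l) x)))" for l
        by (rule pwz_power_integral(1)[OF assms(1,2) y assms(3)])
      show "J holomorphic_on {z. Re z > 0}"
        unfolding J_def by (intro holomorphic_intros) auto
      show "J (complex_of_real l) = (LINT x|wm T. F (add_path y (scale_path (1 / sqrt l) x)))" if "l > 0" for l
        unfolding pwz_power_integral(2)[OF assms(1,2) y assms(3)] J_def using that by (simp add: power_divide)
    qed
    \<comment> \<open>The only possible singularity of J is at 0, which the boundary point avoids
      because q is nonzero.\<close>
    have nz: "- \<i> * complex_of_real q \<noteq> 0" using assms(4) by simp
    then show "isCont J (- \<i> * complex_of_real q)"
      unfolding J_def by (intro continuous_intros) auto
    have "1 / (- \<i> * complex_of_real q) = \<i> / complex_of_real q"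
      using assms(4) by (simp add: field_simps)
    then show "J (- \<i> * complex_of_real q) = (\<Prod>j<n. \<Sum>s = 0..p j. of_nat ((2 * p j) choose (2 * s)) * of_nat (odd_dfact s)
                  * (\<i> / complex_of_real q) ^ s * complex_of_real (pwz T (\<alpha> j) y) ^ (2 * p j - 2 * s))"
      unfolding J_def by (simp only:)
  qed
qed

end
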